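(* Let $m$ be a holomorphic map from $\mathbb{C}^n$ to $\mathbb{P}^1$, and write $m=h/k$ for holomorphic functions $h,k:\mathbb{C}^n\to\mathbb{C}$ with no common zeros. Let $Z(k)\subset\mathbb{C}^n$ denote the zero set of $k$. Then the following statements are equivalent. 1. There exist holomorphic functions $f,g:\mathbb{C}^n\to\mathbb{C}$ such that $m=f+\dfrac{1}{g}$. 2. The function $h$ has a logarithm on $Z(k)$, i.e. there is a holomorphic function $\lambda:Z(k)\to\mathbb{C}$ with $e^{\lambda}=h|_{Z(k)}$. 3. The function $h$ has a logarithm on a neighbourhood of $Z(k)$, i.e. there are an open set $U\supset Z(k)$ in $\mathbb{C}^n$ and a holomorphic function $\lambda':U\to\mathbb{C}$ with $e^{\lambda'}=h|_U$.
   Context: Here $\mathbb{P}^1=\mathbb{C}\cup\{\infty\}$, and a holomorphic map $m:\mathbb{C}^n\to\mathbb{P}^1$ is either a meromorphic function with no indeterminacy or the constant function $\infty$. The equation $m=h/k$ means $m(x)=h(x)/k(x)$ for all $x$, with value $\infty$ where $k(x)=0$; the equation $m=f+1/g$ means $m(x)=f(x)+1/g(x)$ for all $x$, with value $\infty$ where $g(x)=0$ ($g\equiv0$ is allowed, corresponding to $m\equiv\infty$). A function on the analytic subset $Z(k)$ is holomorphic if locally near each point of $Z(k)$ it is the restriction of a holomorphic function on an open subset of $\mathbb{C}^n$. *)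

theory Defs
  imports "HOL-Analysis.Analysis"
begin

text \<open>
  Holomorphy in several complex variables: Frechet differentiability with complex-linear
  derivative. The predicate is meant for open \<open>U\<close>.
\<close>

definition holomorphic_cn_on :: "(complex ^ 'n \<Rightarrow> complex) \<Rightarrow> (complex ^ 'n) set \<Rightarrow> bool"
    (infix "holomorphic'_cn'_on" 50)
  where "f holomorphic_cn_on U \<longleftrightarrow>
    (\<forall>x\<in>U. \<exists>D. (f has_derivative D) (at x) \<and> (\<forall>c v. D (c *s v) = c * D v))"

text \<open>
  Holomorphy on an arbitrary subset \<open>Z\<close> of affine space (used for analytic subsets): the
  function is locally the restriction of a holomorphic function on an open set. Only the values
  of the function on \<open>Z\<close> matter.
\<close>

definition holomorphic_on_subset :: "(complex ^ 'n \<Rightarrow> complex) \<Rightarrow> (complex ^ 'n) set \<Rightarrow> bool"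
    (infix "holomorphic'_on'_subset" 50)
  where "l holomorphic_on_subset Z \<longleftrightarrow>
    (\<forall>z\<in>Z. \<exists>U F. open U \<and> z \<in> U \<and> F holomorphic_cn_on U \<and> (\<forall>y\<in>U \<inter> Z. F y = l y))"

definition zero_set :: "(complex ^ 'n \<Rightarrow> complex) \<Rightarrow> (complex ^ 'n) set"
  where "zero_set k = {x. k x = 0}"

datatype P1 = Finite complex | Infty

text \<open>
  \<open>P1_quot a b\<close> is the point with homogeneous coordinates \<open>[a : b]\<close>; the
  value at \<open>a = b = 0\<close> is a dummy.
\<close>

definition P1_quot :: "complex \<Rightarrow> complex \<Rightarrow> P1"
  where "P1_quot a b = (if b = 0 then Infty else Finite (a / b))"

fun P1_translate :: "complex \<Rightarrow> P1 \<Rightarrow> P1"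
  where
    "P1_translate c (Finite z) = Finite (c + z)"
  | "P1_translate c Infty = Infty"

text \<open>
  Holomorphic maps to the projective line, in the two standard charts: near each point either
  \<open>m\<close> itself or its reciprocal is a holomorphic function with values in the complex plane.
  The constant map \<open>Infty\<close> is included (reciprocal identically zero).
\<close>

definition holomorphic_map_P1 :: "(complex ^ 'n \<Rightarrow> P1) \<Rightarrow> bool"
  where "holomorphic_map_P1 m \<longleftrightarrow>
    (\<forall>x. \<exists>U. open U \<and> x \<in> U \<and>
      ((\<exists>f. f holomorphic_cn_on U \<and> (\<forall>y\<in>U. m y = Finite (f y))) \<or>
       (\<exists>g. g holomorphic_cn_on U \<and> (\<forall>y\<in>U. m y = P1_quot 1 (g y)))))"

end

theory Submission
  imports Defs "HOL-Complex_Analysis.Conformal_Mappings"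
begin

text \<open>
  Given \<open>m = f + 1/g\<close>, the function \<open>h - f k\<close> has no zeros, hence an entire logarithm, which is
  a logarithm of \<open>h\<close> on \<open>Z(k)\<close>; composing with the principal branch of the logarithm corrects
  it to a logarithm of \<open>h\<close> near \<open>Z(k)\<close>.

  Conversely, it suffices to find an entire \<open>\<Lambda>\<close> that is locally congruent modulo \<open>k\<close> to the local
  logarithms of \<open>h\<close> near \<open>Z(k)\<close>: then \<open>h - exp \<Lambda>\<close> is divisible by \<open>k\<close>, and \<open>f = (h - exp \<Lambda>) / k\<close>,
  \<open>g = k exp (- \<Lambda>)\<close>. This is an additive Cousin problem with poles along \<open>Z(k)\<close>. As in Cousin's
  original proof, solutions on two boxes with a common face are merged by splitting a Cauchy
  integral over the boundary of a rectangle in one variable; a fine division then gives solutions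
  near every box, and approximation on balls by Taylor polynomials lets them converge to an entire
  solution.
\<close>

section \<open>Holomorphic functions of several variables\<close>

text \<open>The obstacle is that \<open>k\<close> may vanish with multiplicities: a function that is
  zero on Z(k), such as the difference of two local extensions of the given logarithm, need not be
  divisible by \<open>k\<close>. Local extensions are therefore corrected to exact logarithms of
  \<open>h\<close> on open sets; two of these that agree at a point coincide near it, so their
  difference is divisible by \<open>k\<close> in any case. Off Z(k) a congruence modulo
  \<open>k\<close> is no condition. What remains is to lift a global section of the sheaf O/kO to O.
  Two lifts differ by \<open>k * G\<close> with \<open>G\<close> unique, because \<open>k\<close> is
  not identically zero (the case \<open>k = 0\<close> is treated apart), so splitting and
  approximation can be applied to the ordinary holomorphic function \<open>G\<close>. Congruences
  pass through the exponential because \<open>exp w - 1\<close> is divisible by \<open>w\<close>.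
  Holomorphy means complex Frechet differentiability, whereas limits and integrals are controlled
  one variable at a time; Osgood's lemma bridges the two.\<close>

lemma holomorphic_cn_on_subset:
  "f holomorphic_cn_on U \<Longrightarrow> V \<subseteq> U \<Longrightarrow> f holomorphic_cn_on V"
  unfolding holomorphic_cn_on_def by blast

lemma holomorphic_cn_on_cong:
  assumes "open U" "f holomorphic_cn_on U" "\<And>x. x \<in> U \<Longrightarrow> f x = g x"
  shows "g holomorphic_cn_on U"
  unfolding holomorphic_cn_on_def
proof
  fix x assume "x \<in> U"
  then obtain D where "(f has_derivative D) (at x)" "\<forall>c v. D (c *s v) = c * D v"
    using assms(2) unfolding holomorphic_cn_on_def by blast
  moreover have "(g has_derivative D) (at x)"
    using has_derivative_transform_within_open[OF calculation(1) assms(1) \<open>x \<in> U\<close> assms(3)] by blast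
  ultimately show "\<exists>D. (g has_derivative D) (at x) \<and> (\<forall>c v. D (c *s v) = c * D v)" by blast
qed

lemma holomorphic_cn_on_local:
  assumes "\<And>x. x \<in> U \<Longrightarrow> \<exists>V. x \<in> V \<and> f holomorphic_cn_on V"
  shows "f holomorphic_cn_on U"
  using assms unfolding holomorphic_cn_on_def by blast

lemma holomorphic_cn_on_imp_continuous_on:
  assumes "f holomorphic_cn_on U" shows "continuous_on U f"
  using assms unfolding holomorphic_cn_on_def
  by (intro continuous_at_imp_continuous_on ballI) (blast dest: has_derivative_continuous)

lemma holomorphic_cn_on_const [simp]: "(\<lambda>x. c) holomorphic_cn_on U"
  unfolding holomorphic_cn_on_def by (auto intro!: exI[of _ "\<lambda>_. 0"])

lemma holomorphic_cn_on_coord: "(\<lambda>x. x $ i) holomorphic_cn_on U"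
  unfolding holomorphic_cn_on_def
  by (intro ballI exI[of _ "\<lambda>x. x $ i"] conjI bounded_linear_imp_has_derivative)
     (auto simp: bounded_linear_vec_nth)

lemma holomorphic_cn_on_add:
  assumes "f holomorphic_cn_on U" "g holomorphic_cn_on U"
  shows "(\<lambda>x. f x + g x) holomorphic_cn_on U"
  unfolding holomorphic_cn_on_def
proof
  fix x assume "x \<in> U"
  then obtain D E where "(f has_derivative D) (at x)" "\<forall>c v. D (c *s v) = c * D v"
     "(g has_derivative E) (at x)" "\<forall>c v. E (c *s v) = c * E v"
    using assms unfolding holomorphic_cn_on_def by meson
  then show "\<exists>D. ((\<lambda>x. f x + g x) has_derivative D) (at x) \<and> (\<forall>c v. D (c *s v) = c * D v)"
    by (intro exI[of _ "\<lambda>v. D v + E v"] conjI has_derivative_add) (auto simp: algebra_simps)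
qed

lemma holomorphic_cn_on_mult:
  assumes "f holomorphic_cn_on U" "g holomorphic_cn_on U"
  shows "(\<lambda>x. f x * g x) holomorphic_cn_on U"
  unfolding holomorphic_cn_on_def
proof
  fix x assume "x \<in> U"
  then obtain D E where "(f has_derivative D) (at x)" "\<forall>c v. D (c *s v) = c * D v"
     "(g has_derivative E) (at x)" "\<forall>c v. E (c *s v) = c * E v"
    using assms unfolding holomorphic_cn_on_def by meson
  then show "\<exists>D. ((\<lambda>x. f x * g x) has_derivative D) (at x) \<and> (\<forall>c v. D (c *s v) = c * D v)"
    by (intro exI[of _ "\<lambda>v. f x * E v + D v * g x"] conjI has_derivative_mult)
       (auto simp: algebra_simps)
qed

lemma holomorphic_cn_on_uminus:
  assumes "f holomorphic_cn_on U" shows "(\<lambda>x. - f x) holomorphic_cn_on U"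
  using holomorphic_cn_on_mult[OF holomorphic_cn_on_const[of "-1"] assms] by simp

lemma holomorphic_cn_on_diff:
  assumes "f holomorphic_cn_on U" "g holomorphic_cn_on U"
  shows "(\<lambda>x. f x - g x) holomorphic_cn_on U"
  using holomorphic_cn_on_add[OF assms(1) holomorphic_cn_on_uminus[OF assms(2)]] by simp

lemma holomorphic_cn_on_sum:
  "(\<And>i. i \<in> I \<Longrightarrow> f i holomorphic_cn_on U) \<Longrightarrow> (\<lambda>x. \<Sum>i\<in>I. f i x) holomorphic_cn_on U"
  by (induction I rule: infinite_finite_induct) (auto intro: holomorphic_cn_on_add)

lemma holomorphic_cn_on_compose_holomorphic:
  assumes "f holomorphic_cn_on U" "\<phi> holomorphic_on S" "open S" "\<And>x. x \<in> U \<Longrightarrow> f x \<in> S"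
  shows "(\<lambda>x. \<phi> (f x)) holomorphic_cn_on U"
  unfolding holomorphic_cn_on_def
proof
  fix x assume "x \<in> U"
  then obtain D where D: "(f has_derivative D) (at x)" "\<forall>c v. D (c *s v) = c * D v"
    using assms(1) unfolding holomorphic_cn_on_def by meson
  have "(\<phi> has_field_derivative deriv \<phi> (f x)) (at (f x))"
    using assms \<open>x \<in> U\<close> by (intro holomorphic_derivI) auto
  then have "((\<lambda>x. \<phi> (f x)) has_derivative (\<lambda>v. deriv \<phi> (f x) * D v)) (at x)"
    unfolding has_field_derivative_def by (rule has_derivative_compose[OF D(1)])
  with D(2) show "\<exists>D. ((\<lambda>x. \<phi> (f x)) has_derivative D) (at x) \<and> (\<forall>c v. D (c *s v) = c * D v)"
    by (intro exI[of _ "\<lambda>v. deriv \<phi> (f x) * D v"]) (auto simp: algebra_simps)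
qed

lemma holomorphic_cn_on_exp:
  "f holomorphic_cn_on U \<Longrightarrow> (\<lambda>x. exp (f x)) holomorphic_cn_on U"
  by (rule holomorphic_cn_on_compose_holomorphic[of _ _ exp UNIV]) (auto intro: holomorphic_intros)

lemma holomorphic_cn_on_Ln:
  "f holomorphic_cn_on U \<Longrightarrow> (\<And>x. x \<in> U \<Longrightarrow> f x \<notin> \<real>\<^sub>\<le>\<^sub>0) \<Longrightarrow> (\<lambda>x. Ln (f x)) holomorphic_cn_on U"
  by (rule holomorphic_cn_on_compose_holomorphic[of _ _ Ln "- \<real>\<^sub>\<le>\<^sub>0"]) (auto intro!: holomorphic_intros)

lemma holomorphic_cn_on_divide:
  assumes "f holomorphic_cn_on U" "g holomorphic_cn_on U" "\<And>x. x \<in> U \<Longrightarrow> g x \<noteq> 0"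
  shows "(\<lambda>x. f x / g x) holomorphic_cn_on U"
proof -
  have "(\<lambda>x. inverse (g x)) holomorphic_cn_on U"
    by (rule holomorphic_cn_on_compose_holomorphic[of _ _ inverse "- {0}"])
       (use assms in \<open>auto intro!: holomorphic_intros\<close>)
  from holomorphic_cn_on_mult[OF assms(1) this] show ?thesis by (simp add: divide_inverse)
qed

text \<open>The maps needed are those that replace one coordinate by a constant, and the dilations
  by a point of a circle.\<close>

lemma holomorphic_cn_on_compose_affine:
  fixes L :: "complex ^ 'm \<Rightarrow> complex ^ 'n"
  assumes "f holomorphic_cn_on W" "linear L" "\<And>c v. L (c *s v) = c *s L v"
    and "\<And>x. x \<in> U \<Longrightarrow> a + L x \<in> W"
  shows "(\<lambda>x. f (a + L x)) holomorphic_cn_on U"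
  unfolding holomorphic_cn_on_def
proof
  fix x assume "x \<in> U"
  then obtain D where D: "(f has_derivative D) (at (a + L x))" "\<forall>c v. D (c *s v) = c * D v"
    using assms unfolding holomorphic_cn_on_def by meson
  have "((\<lambda>x. a + L x) has_derivative (\<lambda>v. 0 + L v)) (at x)"
    by (intro has_derivative_add has_derivative_const linear_imp_has_derivative assms)
  then have "((\<lambda>x. f (a + L x)) has_derivative (\<lambda>v. D (0 + L v))) (at x)"
    by (rule has_derivative_compose) (rule D)
  with D(2) assms(3) show "\<exists>D. ((\<lambda>x. f (a + L x)) has_derivative D) (at x) \<and> (\<forall>c v. D (c *s v) = c * D v)"
    by (intro exI[of _ "\<lambda>v. D (0 + L v)"]) auto
qed

section \<open>Restriction to complex lines and Osgood's lemma\<close>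

lemma has_derivative_complex_line:
  "((\<lambda>t. x + t *s (v :: complex ^ 'n)) has_derivative (\<lambda>t. t *s v)) F"
proof -
  have "linear (\<lambda>t. t *s v)"
    by (intro linearI) (auto simp: vec_eq_iff algebra_simps)
  then show ?thesis
    using has_derivative_add[OF has_derivative_const linear_imp_has_derivative] by fastforce
qed

lemma continuous_on_complex_line: "continuous_on S (\<lambda>t. x + t *s (v :: complex ^ 'n))"
  by (intro continuous_at_imp_continuous_on ballI has_derivative_continuous[OF has_derivative_complex_line])

lemma holomorphic_on_complex_line:
  assumes "f holomorphic_cn_on U" "\<And>t. t \<in> S \<Longrightarrow> x + t *s v \<in> U"
  shows "(\<lambda>t. f (x + t *s v)) holomorphic_on S"
  unfolding holomorphic_on_def field_differentiable_def
proof
  fix t assume "t \<in> S"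
  then obtain D where D: "(f has_derivative D) (at (x + t *s v))" "\<forall>c v. D (c *s v) = c * D v"
    using assms unfolding holomorphic_cn_on_def by meson
  have "((\<lambda>t. f (x + t *s v)) has_derivative (\<lambda>t. D (t *s v))) (at t)"
    by (rule has_derivative_compose[OF has_derivative_complex_line D(1)])
  with D(2) have "((\<lambda>t. f (x + t *s v)) has_field_derivative D v) (at t)"
    by (simp add: has_field_derivative_def mult.commute[of _ "D v"])
  then show "\<exists>d. ((\<lambda>t. f (x + t *s v)) has_field_derivative d) (at t within S)"
    using has_field_derivative_at_within by blast
qed

lemma axis_eq_scaled: "axis i t = t *s axis i (1::complex)"
  by (simp add: vec_eq_iff axis_def)

lemma norm_axis [simp]: "norm (axis i (t::complex)) = norm t"
proof -
  have "L2_set (\<lambda>j. norm (axis i t $ j)) UNIV = norm t"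
    by (simp add: L2_set_def axis_def if_distrib[of norm] if_distrib[of "\<lambda>x. x^2"] cong: if_cong)
  then show ?thesis by (simp add: norm_vec_def)
qed

text \<open>On the compact disc \<open>f p\<close> tends to \<open>f p0\<close> uniformly as
  \<open>p\<close> tends to \<open>p0\<close>; Cauchy's inequality for the difference turns this
  into convergence of the derivatives at the centre.\<close>

lemma continuous_on_deriv_param:
  fixes f :: "'p::topological_space \<Rightarrow> complex \<Rightarrow> complex"
  assumes "r > 0" and cont: "continuous_on (P \<times> cball 0 r) (\<lambda>(p, t). f p t)"
    and hol: "\<And>p. p \<in> P \<Longrightarrow> f p holomorphic_on ball 0 r"
  shows "continuous_on P (\<lambda>p. deriv (f p) 0)"
  unfolding continuous_on_def
proof (intro ballI tendstoI)
  fix p0 and e :: real assume p0: "p0 \<in> P" and "e > 0"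
  have contp: "continuous_on (cball 0 r) (f p)" if "p \<in> P" for p
    using continuous_on_compose2[OF cont continuous_on_Pair[OF continuous_on_const continuous_on_id], of p "cball 0 r"] that
    by (auto simp: image_subset_iff)
  \<comment> \<open>With this uniform bound, Cauchy's inequality on radius \<open>r\<close> gives
    \<open>e / 2\<close>, strictly below \<open>e\<close>.\<close>
  have "e * r / 2 > 0" using \<open>e > 0\<close> \<open>r > 0\<close> by simp
  from continuous_on_prod_compactE[OF cont compact_cball p0 this]
  obtain X where X: "p0 \<in> X" "open X"
    and *: "\<forall>p\<in>X \<inter> P. \<forall>t\<in>cball 0 r. dist (f p t) (f p0 t) \<le> e * r / 2"
    by auto
  have "dist (deriv (f p) 0) (deriv (f p0) 0) < e" if p: "p \<in> X \<inter> P" for p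
  proof -
    have "norm ((deriv ^^ 1) (\<lambda>t. f p t - f p0 t) 0) \<le> fact 1 * (e * r / 2) / r ^ 1"
    proof (rule Cauchy_inequality)
      show "continuous_on (cball 0 r) (\<lambda>t. f p t - f p0 t)"
        using contp p p0 by (auto intro!: continuous_intros)
      show "(\<lambda>t. f p t - f p0 t) holomorphic_on ball 0 r"
        using hol p p0 by (auto intro!: holomorphic_intros)
    qed (use * p \<open>r > 0\<close> in \<open>auto simp: dist_norm\<close>)
    moreover have "deriv (\<lambda>t. f p t - f p0 t) 0 = deriv (f p) 0 - deriv (f p0) 0"
      using hol p p0 \<open>r > 0\<close>
      by (intro deriv_diff holomorphic_on_imp_differentiable_at[of _ "ball 0 r"]) auto
    moreover have "e * r / 2 / r < e" using \<open>e > 0\<close> \<open>r > 0\<close> by simp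
    ultimately show ?thesis by (simp add: dist_norm)
  qed
  then show "\<forall>\<^sub>F p in at p0 within P. dist (deriv (f p) 0) (deriv (f p0) 0) < e"
    unfolding eventually_at_topological using X by blast
qed

lemma norm_coordinate_restriction_le: "norm (\<chi> i. if i \<in> S then h $ i else 0) \<le> norm (h :: complex ^ 'n)"
  unfolding norm_vec_def by (intro L2_set_mono) auto

text \<open>Osgood's lemma: the partial derivatives are continuous by the Cauchy estimate.\<close>

lemma holomorphic_cn_on_if_separately:
  fixes f :: "complex ^ 'n \<Rightarrow> complex"
  assumes "open U" and cont: "continuous_on U f"
    and diff: "\<And>x i. x \<in> U \<Longrightarrow> (\<lambda>t. f (x + axis i t)) field_differentiable (at 0)"
  shows "f holomorphic_cn_on U"
  unfolding holomorphic_cn_on_def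
proof
  fix x0 assume "x0 \<in> U"
  then obtain r0 where "r0 > 0" and r0: "cball x0 r0 \<subseteq> U"
    using \<open>open U\<close> open_contains_cball by blast
  \<comment> \<open>Halving leaves room: a point of \<open>ball x0 r\<close> may move by up to
    \<open>r\<close> in one coordinate without leaving \<open>U\<close>.\<close>
  define r where "r = r0 / 2"
  have r: "r > 0" "cball x0 (2 * r) \<subseteq> U" using \<open>r0 > 0\<close> r0 by (auto simp: r_def)
  define p where "p i x = deriv (\<lambda>t. f (x + axis i t)) 0" for i x
  have der: "((\<lambda>t. f (x + axis i t)) has_field_derivative p i (x + axis i t)) (at t)"
    if "x + axis i t \<in> U" for x i t
  proof -
    have eq: "(\<lambda>s. f (x + axis i t + axis i s)) = (\<lambda>s. f (x + axis i (t + s)))"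
      by (intro ext arg_cong[of _ _ f]) (auto simp: vec_eq_iff axis_def)
    have "((\<lambda>s. f (x + axis i (t + s))) has_field_derivative p i (x + axis i t)) (at 0)"
      using diff[OF that, of i] unfolding p_def eq DERIV_deriv_iff_field_differentiable .
    then show ?thesis
      using DERIV_at_within_shift[of "\<lambda>s. f (x + axis i s)" "p i (x + axis i t)" t 0 UNIV] by simp
  qed
  have norm_axis_add: "dist x0 (x + axis i t) \<le> dist x0 x + norm t" for x i and t :: complex
    using norm_triangle_ineq4[of "x0 - x" "axis i t"] by (simp add: dist_norm algebra_simps)
  have contp: "continuous_on (ball x0 r) (p i)" for i
    unfolding p_def
  proof (rule continuous_on_deriv_param[OF \<open>r > 0\<close>])
    have sub: "x + axis i t \<in> U" if "x \<in> ball x0 r" "norm t \<le> r" for x t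
      using r(2) that norm_axis_add[of x i t] by auto
    have "continuous_on (ball x0 r \<times> cball 0 r) (\<lambda>q. fst q + snd q *s axis i 1)"
      unfolding vector_scalar_mult_def
      by (intro continuous_intros continuous_on_vec_lambda)
    then show "continuous_on (ball x0 r \<times> cball 0 r) (\<lambda>(x, t). f (x + axis i t))"
      unfolding case_prod_unfold axis_eq_scaled[of i "snd _"]
      by (rule continuous_on_compose2[OF cont]) (use sub in \<open>auto simp: axis_eq_scaled[symmetric]\<close>)
    show "(\<lambda>t. f (x + axis i t)) holomorphic_on ball 0 r" if "x \<in> ball x0 r" for x
      unfolding holomorphic_on_def field_differentiable_def
    proof
      fix t :: complex assume "t \<in> ball 0 r"
      then have "x + axis i t \<in> U" using sub[OF that, of t] by simp
      from has_field_derivative_at_within[OF der[OF this]]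
      show "\<exists>f'. ((\<lambda>t. f (x + axis i t)) has_field_derivative f') (at t within ball 0 r)" by blast
    qed
  qed
  \<comment> \<open>The coordinates of the increment are switched on one at a time; \<open>S\<close>
    is the set of those already switched on. For \<open>S = UNIV\<close> this is Frechet
    differentiability at \<open>x0\<close>.\<close>
  have claim: "\<exists>d>0. \<forall>h. norm h < d \<longrightarrow>
      norm (f (x0 + (\<chi> i. if i \<in> S then h $ i else 0)) - f x0 - (\<Sum>i\<in>S. p i x0 * h $ i)) \<le> e * norm h"
    if "e > 0" for e and S :: "'n set"
    using finite[of S] \<open>e > 0\<close>
  proof (induction S arbitrary: e rule: finite_induct)
    case empty
    have "x0 + (\<chi> i. 0) = x0" by (simp add: vec_eq_iff)
    then show ?case using empty by (auto intro!: exI[of _ 1])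
  next
    case (insert j S)
    let ?h = "\<lambda>h :: complex ^ 'n. \<chi> i. if i \<in> S then h $ i else 0"
    have "e / 2 > 0" using insert by simp
    from insert.IH[OF this] obtain d1 where "d1 > 0" and d1: "\<And>h. norm h < d1 \<Longrightarrow>
      norm (f (x0 + ?h h) - f x0 - (\<Sum>i\<in>S. p i x0 * h $ i)) \<le> e / 2 * norm h" by blast
    have "isCont (p j) x0" using contp r by (meson centre_in_ball continuous_on_eq_continuous_at open_ball)
    then obtain d2 where "d2 > 0" and d2: "\<And>x. dist x x0 < d2 \<Longrightarrow> dist (p j x) (p j x0) < e / 2"
      using \<open>e / 2 > 0\<close> unfolding continuous_at_eps_delta by blast
    \<comment> \<open>The points met below lie within \<open>2 * norm h\<close> of
      \<open>x0\<close>; hence \<open>d2 / 2\<close> for the continuity of \<open>p j\<close>, and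
      \<open>r\<close> for staying in \<open>cball x0 (2 * r)\<close>.\<close>
    define d where "d = Min {d1, d2 / 2, r}"
    have "d > 0" using \<open>d1 > 0\<close> \<open>d2 > 0\<close> r by (auto simp: d_def)
    moreover have "norm (f (x0 + (\<chi> i. if i \<in> insert j S then h $ i else 0)) - f x0
      - (\<Sum>i\<in>insert j S. p i x0 * h $ i)) \<le> e * norm h" if h: "norm h < d" for h
    proof -
      define y where "y = x0 + ?h h"
      have h': "norm h < d1" "norm h < d2 / 2" "norm h < r" using h by (auto simp: d_def)
      have hj: "norm (h $ j) \<le> norm h" by (rule Finite_Cartesian_Product.norm_nth_le)
      have near: "dist x0 (y + axis j t) < d2" "y + axis j t \<in> U" if "t \<in> cball 0 (norm (h $ j))" for t :: complex
      proof -
        have "dist x0 (y + axis j t) \<le> norm h + norm h"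
          using norm_axis_add[of y j t] norm_coordinate_restriction_le[of S h] that hj
          by (auto simp: y_def dist_norm)
        then show "dist x0 (y + axis j t) < d2" "y + axis j t \<in> U" using h' r(2) by auto
      qed
      \<comment> \<open>Mean value estimate for \<open>f (y + axis j t) - p j x0 * t\<close>, whose
        derivative is at most \<open>e / 2\<close>; the other half of \<open>e\<close> is spent on
        the induction hypothesis.\<close>
      have "norm ((f (y + axis j (h $ j)) - p j x0 * (h $ j)) - (f (y + axis j 0) - p j x0 * 0))
          \<le> e / 2 * norm (h $ j - 0)"
      proof (rule field_differentiable_bound[of "cball 0 (norm (h $ j))" _ "\<lambda>t. p j (y + axis j t) - p j x0 * 1"])
        fix t :: complex assume t: "t \<in> cball 0 (norm (h $ j))"
        show "((\<lambda>t. f (y + axis j t) - p j x0 * t) has_field_derivative p j (y + axis j t) - p j x0 * 1)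
          (at t within cball 0 (norm (h $ j)))"
          by (rule DERIV_diff[OF has_field_derivative_at_within[OF der[OF near(2)[OF t]]] DERIV_cmult[OF DERIV_ident]])
        show "norm (p j (y + axis j t) - p j x0 * 1) \<le> e / 2"
          using d2[of "y + axis j t"] near(1)[OF t] by (auto simp: dist_norm norm_minus_commute)
      qed auto
      moreover have "y + axis j (h $ j) = x0 + (\<chi> i. if i \<in> insert j S then h $ i else 0)"
        using insert.hyps by (auto simp: y_def vec_eq_iff axis_def)
      moreover have "axis j 0 = (0 :: complex ^ 'n)" by (auto simp: vec_eq_iff axis_def)
      ultimately have "norm (f (x0 + (\<chi> i. if i \<in> insert j S then h $ i else 0)) - p j x0 * (h $ j) - f y)
          \<le> e / 2 * norm h"
        by (intro order_trans[OF _ mult_left_mono[OF hj, of "e / 2"]]) (use \<open>e / 2 > 0\<close> in simp_all)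
      from norm_triangle_mono[OF this d1[OF h'(1), folded y_def]]
      show ?thesis using insert.hyps by (simp add: algebra_simps)
    qed
    ultimately show ?case by blast
  qed
  define D where "D v = (\<Sum>i\<in>UNIV. p i x0 * v $ i)" for v
  have "(f has_derivative D) (at x0)"
    unfolding has_derivative_at_alt
  proof (intro conjI allI impI)
    show "bounded_linear D" unfolding D_def
      by (intro bounded_linear_sum bounded_linear_const_mult bounded_linear_vec_nth)
    fix e :: real assume "e > 0"
    from claim[OF this, of UNIV] obtain d where "d > 0"
      and d: "\<And>h. norm h < d \<Longrightarrow> norm (f (x0 + h) - f x0 - D h) \<le> e * norm h"
      unfolding D_def by (auto simp: vec_lambda_eta)
    then show "\<exists>d>0. \<forall>y. norm (y - x0) < d \<longrightarrow> norm (f y - f x0 - D (y - x0)) \<le> e * norm (y - x0)"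
      by (intro exI[of _ d]) (metis add_diff_cancel_left' diff_add_cancel add.commute)
  qed
  moreover have "\<forall>c v. D (c *s v) = c * D v"
    by (simp add: D_def sum_distrib_left algebra_simps)
  ultimately show "\<exists>D. (f has_derivative D) (at x0) \<and> (\<forall>c v. D (c *s v) = c * D v)" by blast
qed

section \<open>Uniform limits and parameter integrals\<close>

lemma continuous_on_add_axis: "continuous_on S (\<lambda>t. (x :: complex ^ 'n) + axis i t)"
  using continuous_on_complex_line[of S x "axis i 1"] by (simp add: axis_eq_scaled[symmetric])

lemma open_axis_slice: "open U \<Longrightarrow> open {t. (x :: complex ^ 'n) + axis i t \<in> U}"
  using open_vimage[OF _ continuous_on_add_axis, of U x i] by (simp add: vimage_def)

lemma holomorphic_on_axis_slice:
  assumes "f holomorphic_cn_on U" "\<And>t. t \<in> S \<Longrightarrow> x + axis i t \<in> U"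
  shows "(\<lambda>t. f (x + axis i t)) holomorphic_on S"
  using holomorphic_on_complex_line[OF assms(1), of S x "axis i 1"] assms(2)
  by (simp add: axis_eq_scaled[symmetric])

lemma cball_add_axis: "cball x r \<subseteq> U \<Longrightarrow> norm t \<le> r \<Longrightarrow> (x :: complex ^ 'n) + axis i t \<in> U"
  by (auto simp: subset_iff dist_norm)

text \<open>Osgood's lemma reduces this to the one-variable Weierstrass theorem on each axis
  slice.\<close>

lemma holomorphic_cn_on_uniform_limit:
  fixes g :: "complex ^ 'n \<Rightarrow> complex"
  assumes "open U" "\<And>n. f n holomorphic_cn_on U" "uniform_limit U f g sequentially"
  shows "g holomorphic_cn_on U"
proof (rule holomorphic_cn_on_if_separately[OF \<open>open U\<close>])
  show "continuous_on U g"
    by (rule uniform_limit_theorem[OF _ assms(3)])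
       (simp_all add: holomorphic_cn_on_imp_continuous_on[OF assms(2)])
  fix x i assume "x \<in> U"
  let ?S = "{t. x + axis i t \<in> U}"
  have "(\<lambda>t. g (x + axis i t)) holomorphic_on ?S"
  proof (rule holomorphic_uniform_sequence)
    show "open ?S" by (rule open_axis_slice[OF \<open>open U\<close>])
    show "(\<lambda>t. f n (x + axis i t)) holomorphic_on ?S" for n
      by (rule holomorphic_on_axis_slice[OF assms(2)]) auto
    fix t assume "t \<in> ?S"
    then obtain d where "d > 0" "cball t d \<subseteq> ?S"
      using open_axis_slice[OF \<open>open U\<close>] open_contains_cball by blast
    moreover have "uniform_limit (cball t d) (\<lambda>n t. f n (x + axis i t)) (\<lambda>t. g (x + axis i t)) sequentially"
      using assms(3) calculation(2) unfolding uniform_limit_iff by (fast elim: eventually_mono)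
    ultimately show "\<exists>d>0. cball t d \<subseteq> ?S \<and>
       uniform_limit (cball t d) (\<lambda>n t. f n (x + axis i t)) (\<lambda>t. g (x + axis i t)) sequentially" by blast
  qed
  moreover have "0 \<in> ?S" using \<open>x \<in> U\<close> by (simp add: axis_def zero_vec_def[symmetric])
  ultimately show "(\<lambda>t. g (x + axis i t)) field_differentiable at 0"
    using open_axis_slice[OF \<open>open U\<close>] holomorphic_on_imp_differentiable_at by blast
qed

text \<open>Osgood's lemma combined with differentiation under the integral sign in one coordinate.
  Contour integrals enter in this form, parametrized over the unit interval.\<close>

lemma holomorphic_cn_on_integral:
  fixes f :: "complex ^ 'n \<Rightarrow> real \<Rightarrow> complex"
  assumes "open U" and cont: "continuous_on (U \<times> {0..1}) (\<lambda>(x, s). f x s)"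
    and hol: "\<And>s. s \<in> {0..1} \<Longrightarrow> (\<lambda>x. f x s) holomorphic_cn_on U"
  shows "(\<lambda>x. integral {0..1} (f x)) holomorphic_cn_on U"
proof (rule holomorphic_cn_on_if_separately[OF \<open>open U\<close>])
  show "continuous_on U (\<lambda>x. integral {0..1} (f x))"
    by (rule integral_continuous_on_param[of U 0 1 f, unfolded box_real, OF cont])
  fix x i assume "x \<in> U"
  then obtain r0 where "r0 > 0" and r0: "cball x r0 \<subseteq> U"
    using \<open>open U\<close> open_contains_cball by blast
  define r where "r = r0 / 2"
  have r: "r > 0" "cball x (2 * r) \<subseteq> U" using \<open>r0 > 0\<close> r0 by (auto simp: r_def)
  have sub: "x + axis i t \<in> U" if "norm t \<le> 2 * r" for t
    using cball_add_axis[OF r(2) that] .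
  have add: "x + axis i t + axis i w = x + axis i (t + w)" for t w
    by (auto simp: vec_eq_iff axis_def)
  have ctw: "continuous_on ((ball 0 r \<times> {0..1}) \<times> cball 0 r) (\<lambda>q. (x + (fst (fst q) + snd q) *s axis i 1, snd (fst q)))"
    unfolding vector_scalar_mult_def
    by (intro continuous_intros continuous_on_vec_lambda)
  have "(\<lambda>t. integral (cbox 0 1) (f (x + axis i t))) holomorphic_on ball 0 r"
  \<comment> \<open>The derivative at \<open>t\<close> is written as a derivative at 0 of a shifted
    function, so that its joint continuity is an instance of the continuity of derivatives with
    parameter \<open>(t, s)\<close>.\<close>
  proof (rule leibniz_rule_holomorphic[where fx = "\<lambda>t s. deriv (\<lambda>w. f (x + axis i (t + w)) s) 0"])
    fix t :: complex and s :: real assume t: "t \<in> ball 0 r" and s: "s \<in> cbox 0 1"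
    have "(\<lambda>t. f (x + axis i t) s) holomorphic_on ball 0 (2 * r)"
      by (rule holomorphic_on_axis_slice[OF hol]) (use s sub in auto)
    then have "(\<lambda>t. f (x + axis i t) s) field_differentiable at t"
      by (rule holomorphic_on_imp_differentiable_at) (use t r in auto)
    then have *: "((\<lambda>t. f (x + axis i t) s) has_field_derivative deriv (\<lambda>t. f (x + axis i t) s) t) (at (t + 0))"
      by (simp add: DERIV_deriv_iff_field_differentiable)
    then have "((\<lambda>w. f (x + axis i (t + w)) s) has_field_derivative deriv (\<lambda>t. f (x + axis i t) s) t) (at 0)"
      using DERIV_at_within_shift[of "\<lambda>t. f (x + axis i t) s" _ t 0 UNIV] by simp
    then have "deriv (\<lambda>w. f (x + axis i (t + w)) s) 0 = deriv (\<lambda>t. f (x + axis i t) s) t"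
      by (rule DERIV_imp_deriv)
    with * show "((\<lambda>t. f (x + axis i t) s) has_field_derivative deriv (\<lambda>w. f (x + axis i (t + w)) s) 0) (at t within ball 0 r)"
      using has_field_derivative_at_within by fastforce
  next
    fix t :: complex assume t: "t \<in> ball 0 r"
    have "continuous_on (cbox 0 1) (f (x + axis i t))"
      using continuous_on_compose2[OF cont continuous_on_Pair[OF continuous_on_const continuous_on_id], of "x + axis i t" "cbox 0 1"] sub[of t] t r
      by (auto simp: image_subset_iff)
    then show "f (x + axis i t) integrable_on cbox 0 1" by (rule integrable_continuous)
  next
    have "continuous_on (ball 0 r \<times> {0..1}) (\<lambda>p. deriv (\<lambda>w. f (x + axis i (fst p + w)) (snd p)) 0)"
    proof (rule continuous_on_deriv_param[OF r(1)])
      have "continuous_on ((ball 0 r \<times> {0..1}) \<times> cball 0 r)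
         (\<lambda>q. f (fst (x + (fst (fst q) + snd q) *s axis i 1, snd (fst q))) (snd (x + (fst (fst q) + snd q) *s axis i 1, snd (fst q))))"
      proof (rule continuous_on_compose2[OF cont[unfolded case_prod_unfold] ctw], rule image_subsetI)
        fix q :: "(complex \<times> real) \<times> complex" assume q: "q \<in> (ball 0 r \<times> {0..1}) \<times> cball 0 r"
        then have "norm (fst (fst q) + snd q) \<le> 2 * r"
          using norm_triangle_ineq[of "fst (fst q)" "snd q"] by (auto simp: mem_Times_iff)
        from sub[OF this] q show "(x + (fst (fst q) + snd q) *s axis i 1, snd (fst q)) \<in> U \<times> {0..1}"
          by (simp add: axis_eq_scaled[symmetric] mem_Times_iff)
      qed
      then show "continuous_on ((ball 0 r \<times> {0..1}) \<times> cball 0 r) (\<lambda>(p, w). f (x + axis i (fst p + w)) (snd p))"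
        by (simp add: case_prod_unfold axis_eq_scaled[symmetric])
      fix p :: "complex \<times> real" assume p: "p \<in> ball 0 r \<times> {0..1}"
      have slice: "x + axis i (fst p) + axis i w \<in> U" if "w \<in> ball 0 r" for w
        using sub[of "fst p + w"] norm_triangle_ineq[of "fst p" w] p that by (auto simp: add)
      from p have "(\<lambda>w. f ((x + axis i (fst p)) + axis i w) (snd p)) holomorphic_on ball 0 r"
        by (intro holomorphic_on_axis_slice[OF hol]) (use slice in auto)
      then show "(\<lambda>w. f (x + axis i (fst p + w)) (snd p)) holomorphic_on ball 0 r"
        by (simp add: add)
    qed
    then show "continuous_on (ball 0 r \<times> cbox 0 1) (\<lambda>(t, s). deriv (\<lambda>w. f (x + axis i (t + w)) s) 0)"
      by (simp add: case_prod_unfold)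
  qed auto
  then show "(\<lambda>t. integral {0..1} (f (x + axis i t))) field_differentiable at 0"
    using r(1) holomorphic_on_imp_differentiable_at[of _ "ball 0 r" 0] by simp
qed

section \<open>Divisibility of germs\<close>

text \<open>The germ of \<open>A\<close> lies in the principal ideal generated by \<open>k\<close>
  in the ring of germs at \<open>p\<close>. If \<open>k\<close> has multiple factors, this is
  stronger than vanishing on its zero set.\<close>

definition germ_dvd :: "(complex ^ 'n \<Rightarrow> complex) \<Rightarrow> (complex ^ 'n \<Rightarrow> complex) \<Rightarrow> complex ^ 'n \<Rightarrow> bool"
  where "germ_dvd k A p \<longleftrightarrow>
    (\<exists>V G. open V \<and> p \<in> V \<and> G holomorphic_cn_on V \<and> (\<forall>y\<in>V. A y = k y * G y))"

lemma germ_dvdI: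
  assumes "open V" "p \<in> V" "G holomorphic_cn_on V" "\<And>y. y \<in> V \<Longrightarrow> A y = k y * G y"
  shows "germ_dvd k A p"
  using assms unfolding germ_dvd_def by blast

lemma germ_dvd_add:
  assumes "germ_dvd k A p" "germ_dvd k B p"
  shows "germ_dvd k (\<lambda>y. A y + B y) p"
proof -
  obtain V G V' G' where
    V: "open V" "p \<in> V" "G holomorphic_cn_on V" "\<forall>y\<in>V. A y = k y * G y" and
    V': "open V'" "p \<in> V'" "G' holomorphic_cn_on V'" "\<forall>y\<in>V'. B y = k y * G' y"
    using assms unfolding germ_dvd_def by metis
  show ?thesis
  proof (rule germ_dvdI)
    show "(\<lambda>y. G y + G' y) holomorphic_cn_on (V \<inter> V')"
      using V(3) V'(3) by (intro holomorphic_cn_on_add) (auto intro: holomorphic_cn_on_subset)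
  qed (use V V' in \<open>auto simp: algebra_simps\<close>)
qed

lemma germ_dvd_cong:
  assumes "germ_dvd k A p" "open U" "p \<in> U" "\<And>y. y \<in> U \<Longrightarrow> A y = B y"
  shows "germ_dvd k B p"
proof -
  obtain V G where
    V: "open V" "p \<in> V" "G holomorphic_cn_on V" "\<forall>y\<in>V. A y = k y * G y"
    using assms unfolding germ_dvd_def by metis
  show ?thesis
    by (rule germ_dvdI[of "V \<inter> U" _ G])
       (use V assms(2-) in \<open>auto intro: holomorphic_cn_on_subset\<close>)
qed

lemma germ_dvd_uminus:
  assumes "germ_dvd k A p" shows "germ_dvd k (\<lambda>y. - A y) p"
proof -
  obtain V G where
    V: "open V" "p \<in> V" "G holomorphic_cn_on V" "\<forall>y\<in>V. A y = k y * G y"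
    using assms unfolding germ_dvd_def by metis
  show ?thesis
    by (rule germ_dvdI[of V _ "\<lambda>y. - G y"]) (use V holomorphic_cn_on_uminus in auto)
qed

lemma germ_dvd_diff:
  assumes "germ_dvd k A p" "germ_dvd k B p"
  shows "germ_dvd k (\<lambda>y. A y - B y) p"
  using germ_dvd_add[OF assms(1) germ_dvd_uminus[OF assms(2)]] by simp

text \<open>Near \<open>p\<close> the function \<open>k\<close> is a unit, so congruences modulo
  \<open>k\<close> have content only on its zero set.\<close>

lemma germ_dvd_nonzero:
  assumes "open V" "p \<in> V" "A holomorphic_cn_on V" "k holomorphic_cn_on V" "k p \<noteq> 0"
  shows "germ_dvd k A p"
proof (rule germ_dvdI)
  let ?V = "{x \<in> V. k x \<noteq> 0}"
  show "open ?V"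
    using continuous_open_preimage[OF holomorphic_cn_on_imp_continuous_on[OF assms(4)] assms(1) open_delete[OF open_UNIV, of 0]]
    by (simp add: vimage_def Int_def)
  show "(\<lambda>y. A y / k y) holomorphic_cn_on ?V"
    using assms(3,4) by (intro holomorphic_cn_on_divide) (auto intro: holomorphic_cn_on_subset)
qed (use assms in auto)

text \<open>Restricting to the complex line through a point of \<open>U\<close> and a point where \<open>k\<close> does not
  vanish reduces this to the identity theorem in one variable.\<close>

lemma holomorphic_cn_nonzero_dense:
  assumes "k holomorphic_cn_on UNIV" "k w \<noteq> 0" "open U" "x \<in> U"
  shows "\<exists>y\<in>U. k y \<noteq> 0"
proof (rule ccontr)
  assume contra: "\<not> ?thesis"
  let ?l = "\<lambda>t. x + t *s (w - x)"
  have "open (?l -` U)"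
    by (rule open_vimage[OF \<open>open U\<close> continuous_on_complex_line])
  moreover have "0 \<in> ?l -` U" using \<open>x \<in> U\<close> by simp
  moreover have "(\<lambda>t. k (?l t)) holomorphic_on UNIV"
    by (rule holomorphic_on_complex_line[OF assms(1)]) simp
  moreover have "k (?l t) = 0" if "t \<in> ?l -` U" for t
    using contra that by blast
  ultimately have "k (?l 1) = 0"
    using analytic_continuation_open[of "?l -` U" UNIV "\<lambda>t. k (?l t)" "\<lambda>_. 0" 1]
    by (simp only: open_UNIV connected_UNIV subset_UNIV holomorphic_on_const UNIV_I) blast
  with assms(2) show False by simp
qed

text \<open>The two factors agree where \<open>k\<close> does not vanish, a dense set, and
  continuity does the rest.\<close>

lemma holomorphic_cn_cancel:
  assumes k: "k holomorphic_cn_on UNIV" "k w \<noteq> 0" and "open U"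
    and "continuous_on U G" "continuous_on U G'" "\<And>y. y \<in> U \<Longrightarrow> k y * G y = k y * G' y" "x \<in> U"
  shows "G x = G' x"
proof (rule ccontr)
  assume "G x \<noteq> G' x"
  let ?V = "{y \<in> U. G y - G' y \<noteq> 0}"
  have "open ?V"
    using continuous_open_preimage[OF continuous_on_diff[OF assms(4,5)] \<open>open U\<close> open_delete[OF open_UNIV, of 0]]
    by (simp add: vimage_def Int_def)
  then obtain y where "y \<in> ?V" "k y \<noteq> 0"
    using holomorphic_cn_nonzero_dense[OF k, of ?V x] \<open>G x \<noteq> G' x\<close> \<open>x \<in> U\<close> by auto
  with assms(6)[of y] show False by auto
qed

text \<open>Quotients by \<open>k\<close> are unique by cancellation, so those chosen near different
  points agree on overlaps and glue without any obstruction.\<close>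

lemma germ_dvd_imp_global:
  assumes k: "k holomorphic_cn_on UNIV" "k w \<noteq> 0" and "open U" and dvd: "\<And>p. p \<in> U \<Longrightarrow> germ_dvd k A p"
  shows "\<exists>G. G holomorphic_cn_on U \<and> (\<forall>y\<in>U. A y = k y * G y)"
proof -
  have "\<forall>p. \<exists>V G. p \<in> U \<longrightarrow> open V \<and> p \<in> V \<and> G holomorphic_cn_on V \<and> (\<forall>y\<in>V. A y = k y * G y)"
    using dvd unfolding germ_dvd_def by blast
  then obtain V G where VG: "\<And>p. p \<in> U \<Longrightarrow> open (V p) \<and> p \<in> V p \<and> G p holomorphic_cn_on V p \<and> (\<forall>y\<in>V p. A y = k y * G p y)"
    by metis
  have eq: "G p y = G y y" if py: "p \<in> U" "y \<in> U" "y \<in> V p" for p y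
  proof (rule holomorphic_cn_cancel[OF k, of "V p \<inter> V y" "G p" "G y"])
    show "continuous_on (V p \<inter> V y) (G p)" "continuous_on (V p \<inter> V y) (G y)"
      using VG[of p] VG[of y] that
      by (auto intro!: holomorphic_cn_on_imp_continuous_on intro: holomorphic_cn_on_subset)
    show "k z * G p z = k z * G y z" if z: "z \<in> V p \<inter> V y" for z
    proof -
      have "A z = k z * G p z" "A z = k z * G y z" using VG[OF py(1)] VG[OF py(2)] z by auto
      then show ?thesis by (rule trans[OF sym])
    qed
  qed (use VG[of p] VG[of y] that in auto)
  \<comment> \<open>The glued quotient takes at \<open>y\<close> the value of the quotient chosen at
    \<open>y\<close> itself.\<close>
  have "(\<lambda>y. G y y) holomorphic_cn_on U"
  proof (rule holomorphic_cn_on_local)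
    fix p assume p: "p \<in> U"
    have "(\<lambda>y. G y y) holomorphic_cn_on V p \<inter> U"
      by (rule holomorphic_cn_on_cong[of _ "G p"])
         (use VG[OF p] \<open>open U\<close> eq[OF p] in \<open>auto intro: holomorphic_cn_on_subset\<close>)
    with VG[OF p] p show "\<exists>V. p \<in> V \<and> (\<lambda>y. G y y) holomorphic_cn_on V" by blast
  qed
  moreover have "\<forall>y\<in>U. A y = k y * G y y" using VG by blast
  ultimately show ?thesis by blast
qed

section \<open>Splitting along a face of a box\<close>

text \<open>The sides are kept apart, and continuity of the integrand on them is recorded, so that
  two opposite sides can be subdivided afterwards.\<close>

lemma contour_integral_rectangle:
  assumes "Re a1 < Re a3" "Im a1 < Im a3"
    and "a2 = Complex (Re a3) (Im a1)" "a4 = Complex (Re a1) (Im a3)"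
    and "convex S" "open S" "cbox a1 a3 \<subseteq> S" "g holomorphic_on S" "z \<in> box a1 a3"
  defines "f \<equiv> \<lambda>\<zeta>. g \<zeta> / (\<zeta> - z)"
  shows "2 * pi * \<i> * g z = contour_integral (linepath a1 a2) f + contour_integral (linepath a2 a3) f
      + contour_integral (linepath a3 a4) f + contour_integral (linepath a4 a1) f"
    and "continuous_on (cbox a1 a3 - box a1 a3) f"
proof -
  have contS: "continuous_on (S - {z}) f"
    unfolding f_def using assms(8)
    by (intro continuous_intros holomorphic_on_imp_continuous_on) (auto intro: holomorphic_on_subset)
  have zS: "z \<in> S" using assms(7,9) box_subset_cbox by blast
  have img: "path_image (rectpath a1 a3) = cbox a1 a3 - box a1 a3"
    using assms(1,2) by (intro path_image_rectpath_cbox_minus_box) auto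
  show cont: "continuous_on (cbox a1 a3 - box a1 a3) f"
    by (rule continuous_on_subset[OF contS]) (use assms(7,9) in auto)
  have "(f has_contour_integral (2 * pi * \<i> * winding_number (rectpath a1 a3) z * g z)) (rectpath a1 a3)"
    unfolding f_def
    by (rule Cauchy_integral_formula_convex_simple[OF \<open>convex S\<close>])
       (use assms zS img in \<open>auto simp: interior_open\<close>)
  then have "contour_integral (rectpath a1 a3) f = 2 * pi * \<i> * g z"
    using winding_number_rectpath[OF assms(9)] by (simp add: contour_integral_unique)
  moreover have segs: "closed_segment a1 a2 \<union> closed_segment a2 a3 \<union> closed_segment a3 a4 \<union> closed_segment a4 a1
      = cbox a1 a3 - box a1 a3"
    unfolding img[symmetric] using assms(3,4) by (simp add: rectpath_def Let_def path_image_join Un_ac)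
  have "f contour_integrable_on linepath a1 a2" "f contour_integrable_on linepath a2 a3"
    "f contour_integrable_on linepath a3 a4" "f contour_integrable_on linepath a4 a1"
    by (intro contour_integrable_continuous_linepath continuous_on_subset[OF cont]; use segs in blast)+
  then have "contour_integral (rectpath a1 a3) f = contour_integral (linepath a1 a2) f
     + (contour_integral (linepath a2 a3) f + (contour_integral (linepath a3 a4) f + contour_integral (linepath a4 a1) f))"
    using assms(3,4) by (simp add: rectpath_def Let_def contour_integrable_joinI)
  ultimately show "2 * pi * \<i> * g z = contour_integral (linepath a1 a2) f + contour_integral (linepath a2 a3) f
      + contour_integral (linepath a3 a4) f + contour_integral (linepath a4 a1) f"
    by (metis add.assoc)
qed

text \<open>The cut points \<open>m1\<close> and \<open>m2\<close> on the horizontal sides divide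
  the boundary into a chain through the right-hand side and one through the left-hand side. Each
  partial Cauchy integral extends holomorphically across the vertical side that its chain
  omits.\<close>

lemma contour_integral_rectangle_split_Re:
  assumes "Re a1 < c" "c < Re a3" "Im a1 < Im a3"
    and "convex S" "open S" "cbox a1 a3 \<subseteq> S" "g holomorphic_on S" "z \<in> box a1 a3"
  defines "f \<equiv> \<lambda>\<zeta>. g \<zeta> / (\<zeta> - z)"
  defines "a2 \<equiv> Complex (Re a3) (Im a1)" and "a4 \<equiv> Complex (Re a1) (Im a3)"
    and "m1 \<equiv> Complex c (Im a1)" and "m2 \<equiv> Complex c (Im a3)"
  shows "2 * pi * \<i> * g z =
     (\<Sum>(u, v)\<leftarrow>[(m1, a2), (a2, a3), (a3, m2)]. contour_integral (linepath u v) f) +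
     (\<Sum>(u, v)\<leftarrow>[(m2, a4), (a4, a1), (a1, m1)]. contour_integral (linepath u v) f)"
proof -
  note rect = contour_integral_rectangle[OF _ assms(3) refl refl assms(4-8), folded f_def a2_def a4_def]
  have m1: "m1 \<in> closed_segment a1 a2" and m2: "m2 \<in> closed_segment a3 a4"
    using assms(1,2) by (simp_all add: closed_segment_same_Im closed_segment_eq_real_ivl a2_def a4_def m1_def m2_def)
  have "closed_segment a1 a2 \<subseteq> cbox a1 a3 - box a1 a3" "closed_segment a3 a4 \<subseteq> cbox a1 a3 - box a1 a3"
    using assms(1-3) by (auto simp: closed_segment_same_Im closed_segment_eq_real_ivl a2_def a4_def
      in_box_complex_iff in_cbox_complex_iff)
  then have "continuous_on (closed_segment a1 a2) f" "continuous_on (closed_segment a3 a4) f"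
    using rect(2) assms(1,2) by (auto intro: continuous_on_subset)
  from contour_integral_split_linepath[OF this(1) m1] contour_integral_split_linepath[OF this(2) m2]
  show ?thesis using rect(1) assms(1,2) by simp
qed

text \<open>Counterpart for faces on which the imaginary part of a coordinate is constant: an upper
  and a lower chain.\<close>

lemma contour_integral_rectangle_split_Im:
  assumes "Re a1 < Re a3" "Im a1 < d" "d < Im a3"
    and "convex S" "open S" "cbox a1 a3 \<subseteq> S" "g holomorphic_on S" "z \<in> box a1 a3"
  defines "f \<equiv> \<lambda>\<zeta>. g \<zeta> / (\<zeta> - z)"
  defines "a2 \<equiv> Complex (Re a3) (Im a1)" and "a4 \<equiv> Complex (Re a1) (Im a3)"
    and "m1 \<equiv> Complex (Re a3) d" and "m2 \<equiv> Complex (Re a1) d"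
  shows "2 * pi * \<i> * g z =
     (\<Sum>(u, v)\<leftarrow>[(m1, a3), (a3, a4), (a4, m2)]. contour_integral (linepath u v) f) +
     (\<Sum>(u, v)\<leftarrow>[(m2, a1), (a1, a2), (a2, m1)]. contour_integral (linepath u v) f)"
proof -
  note rect = contour_integral_rectangle[OF assms(1) _ refl refl assms(4-8), folded f_def a2_def a4_def]
  have m1: "m1 \<in> closed_segment a2 a3" and m2: "m2 \<in> closed_segment a4 a1"
    using assms(2,3) by (simp_all add: closed_segment_same_Re closed_segment_eq_real_ivl a2_def a4_def m1_def m2_def)
  have "closed_segment a2 a3 \<subseteq> cbox a1 a3 - box a1 a3" "closed_segment a4 a1 \<subseteq> cbox a1 a3 - box a1 a3"
    using assms(1-3) by (auto simp: closed_segment_same_Re closed_segment_eq_real_ivl a2_def a4_def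
      in_box_complex_iff in_cbox_complex_iff)
  then have "continuous_on (closed_segment a2 a3) f" "continuous_on (closed_segment a4 a1) f"
    using rect(2) assms(2,3) by (auto intro: continuous_on_subset)
  from contour_integral_split_linepath[OF this(1) m1] contour_integral_split_linepath[OF this(2) m2]
  show ?thesis using rect(1) assms(2,3) by simp
qed

text \<open>Only the kernel depends on the \<open>i\<close>-th coordinate of \<open>x\<close>: in
  the argument of \<open>G\<close> it is replaced by \<zeta>. Hence \<open>N\<close> may reach
  outside \<open>W\<close> in that direction, as long as it avoids the segment.\<close>

lemma holomorphic_cn_on_cauchy_segment:
  fixes G :: "complex ^ 'n \<Rightarrow> complex"
  assumes "open N" "G holomorphic_cn_on W"
    and W: "\<And>x \<zeta>. x \<in> N \<Longrightarrow> \<zeta> \<in> closed_segment u v \<Longrightarrow> x + axis i (\<zeta> - x $ i) \<in> W"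
    and avoid: "\<And>x. x \<in> N \<Longrightarrow> x $ i \<notin> closed_segment u v"
  shows "(\<lambda>x. contour_integral (linepath u v) (\<lambda>\<zeta>. G (x + axis i (\<zeta> - x $ i)) / (\<zeta> - x $ i))) holomorphic_cn_on N"
proof -
  define \<phi> where "\<phi> x s = G (x + axis i (linepath u v s - x $ i)) / (linepath u v s - x $ i) * (v - u)" for x s
  have seg: "linepath u v s \<in> closed_segment u v" if "s \<in> {0..1}" for s
    using that linepath_in_path by blast
  have "(\<lambda>x. integral {0..1} (\<phi> x)) holomorphic_cn_on N"
  proof (rule holomorphic_cn_on_integral[OF \<open>open N\<close>])
    have 1: "continuous_on (N \<times> {0..1}) (\<lambda>q. fst q + (linepath u v (snd q) - fst q $ i) *s axis i 1)"
      unfolding vector_scalar_mult_def linepath_def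
      by (intro continuous_intros continuous_on_vec_lambda)
    have 2: "continuous_on (N \<times> {0..1}) (\<lambda>q. G (fst q + (linepath u v (snd q) - fst q $ i) *s axis i 1))"
      by (rule continuous_on_compose2[OF holomorphic_cn_on_imp_continuous_on[OF assms(2)] 1])
         (use W seg in \<open>auto simp: axis_eq_scaled[symmetric]\<close>)
    have 3: "continuous_on (N \<times> {0..1}) (\<lambda>q. linepath u v (snd q) - fst q $ i)"
      unfolding linepath_def by (intro continuous_intros)
    have 4: "\<forall>q\<in>N \<times> {0..1}. linepath u v (snd q) - fst q $ i \<noteq> 0"
      using avoid seg by fastforce
    have "continuous_on (N \<times> {0..1}) (\<lambda>q. G (fst q + (linepath u v (snd q) - fst q $ i) *s axis i 1)
        / (linepath u v (snd q) - fst q $ i) * (v - u))"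
      by (intro continuous_on_mult continuous_on_const continuous_on_divide[OF 2 3 4])
    then show "continuous_on (N \<times> {0..1}) (\<lambda>(x, s). \<phi> x s)"
      by (simp add: \<phi>_def case_prod_unfold axis_eq_scaled[symmetric])
    fix s :: real assume s: "s \<in> {0..1}"
    \<comment> \<open>\<open>?L\<close> deletes coordinate \<open>i\<close>, so substituting a fixed
      number for that coordinate is an affine map with complex-linear part.\<close>
    let ?L = "\<lambda>x :: complex ^ 'n. \<chi> j. if j = i then 0 else x $ j"
    have "(\<lambda>x. G (axis i (linepath u v s) + ?L x)) holomorphic_cn_on N"
    proof (rule holomorphic_cn_on_compose_affine[OF assms(2)])
      show "linear ?L" by (intro linearI) (auto simp: vec_eq_iff)
      show "?L (c *s x) = c *s ?L x" for c x by (auto simp: vec_eq_iff)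
      fix x assume "x \<in> N"
      have "axis i (linepath u v s) + ?L x = x + axis i (linepath u v s - x $ i)"
        by (auto simp: vec_eq_iff axis_def)
      with W[OF \<open>x \<in> N\<close> seg[OF s]] show "axis i (linepath u v s) + ?L x \<in> W" by simp
    qed
    moreover have "axis i (linepath u v s) + ?L x = x + axis i (linepath u v s - x $ i)" for x
      by (auto simp: vec_eq_iff axis_def)
    ultimately have "(\<lambda>x. G (x + axis i (linepath u v s - x $ i))) holomorphic_cn_on N" by simp
    moreover have "linepath u v s - x $ i \<noteq> 0" if "x \<in> N" for x
      using avoid[OF that] seg[OF s] by auto
    ultimately show "(\<lambda>x. \<phi> x s) holomorphic_cn_on N"
      unfolding \<phi>_def
      by (intro holomorphic_cn_on_mult holomorphic_cn_on_divide holomorphic_cn_on_diff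
         holomorphic_cn_on_const holomorphic_cn_on_coord)
  qed
  then show ?thesis
    unfolding \<phi>_def contour_integral_integral vector_derivative_linepath_at .
qed

lemma compact_box_enlargement:
  fixes p q :: "'a::euclidean_space"
  assumes "cbox p q \<subseteq> W" "open W" "\<And>i. i \<in> Basis \<Longrightarrow> p \<bullet> i \<le> q \<bullet> i"
  obtains e where "e > 0" "box (p - e *\<^sub>R One) (q + e *\<^sub>R One) \<subseteq> W"
proof -
  obtain d where "d > 0" and d: "(\<Union>x\<in>cbox p q. ball x d) \<subseteq> W"
    using compact_subset_open_imp_ball_epsilon_subset[OF compact_cbox assms(2,1)] by blast
  \<comment> \<open>Moving every coordinate by at most \<open>e\<close> changes a point by at most
    \<open>d / 2\<close> in norm.\<close>
  define e where "e = d / (2 * DIM('a))"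
  have "e > 0" using \<open>d > 0\<close> by (simp add: e_def)
  moreover have "y \<in> W" if y: "y \<in> box (p - e *\<^sub>R One) (q + e *\<^sub>R One)" for y
  proof -
    \<comment> \<open>Clamping each coordinate of \<open>y\<close> gives a nearby point of the
      box.\<close>
    define x where "x = (\<Sum>i\<in>Basis. (max (p \<bullet> i) (min (q \<bullet> i) (y \<bullet> i))) *\<^sub>R i)"
    have xi: "x \<bullet> i = max (p \<bullet> i) (min (q \<bullet> i) (y \<bullet> i))" if "i \<in> Basis" for i
      using that by (simp add: x_def)
    have "x \<in> cbox p q" using assms(3) by (auto simp: mem_box xi)
    moreover have "norm (y - x) \<le> (\<Sum>i\<in>Basis. \<bar>(y - x) \<bullet> i\<bar>)" by (rule norm_le_l1)
    moreover have "(\<Sum>i\<in>Basis. \<bar>(y - x) \<bullet> i\<bar>) \<le> (\<Sum>i::'a\<in>Basis. e)"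
    proof (rule sum_mono)
      fix i :: 'a assume i: "i \<in> Basis"
      then have "p \<bullet> i - e < y \<bullet> i" "y \<bullet> i < q \<bullet> i + e"
        using y by (auto simp: mem_box algebra_simps)
      then show "\<bar>(y - x) \<bullet> i\<bar> \<le> e"
        using \<open>e > 0\<close> assms(3)[OF i] by (auto simp: inner_diff_left xi[OF i])
    qed
    moreover have "(\<Sum>i::'a\<in>Basis. e) < d" using \<open>d > 0\<close> by (simp add: e_def)
    ultimately show ?thesis using d by (force simp: dist_norm norm_minus_commute)
  qed
  ultimately show ?thesis using that by blast
qed

text \<open>Boxes refer to the underlying real space; as products of plane rectangles they admit
  contour integration in one coordinate.\<close>

lemma mem_box_complex_vec:
  fixes x :: "complex ^ 'n"
  shows "x \<in> box p q \<longleftrightarrow> (\<forall>j. x $ j \<in> box (p $ j) (q $ j))"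
    and "x \<in> cbox p q \<longleftrightarrow> (\<forall>j. x $ j \<in> cbox (p $ j) (q $ j))"
  by (auto simp: mem_box Basis_vec_def inner_axis Basis_complex_def)

lemma One_complex_vec_nth: "(One :: complex ^ 'n) $ j = Complex 1 1"
proof -
  have "axis j 1 \<in> (Basis :: (complex ^ 'n) set)" "axis j \<i> \<in> (Basis :: (complex ^ 'n) set)"
    by (auto simp: Basis_vec_def Basis_complex_def)
  then have "(One :: complex ^ 'n) \<bullet> axis j 1 = 1" "(One :: complex ^ 'n) \<bullet> axis j \<i> = 1"
    by (auto intro!: inner_sum_Basis)
  then show ?thesis by (simp add: inner_axis complex_eq_iff inner_complex_def)
qed

lemma scaleR_One_complex_vec_nth: "(t *\<^sub>R (One :: complex ^ 'n)) $ j = Complex t t"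
proof -
  have "(t *\<^sub>R (One :: complex ^ 'n)) $ j = t *\<^sub>R Complex 1 1"
    unfolding vector_scaleR_component One_complex_vec_nth ..
  then show ?thesis by (simp add: complex_eq_iff)
qed

text \<open>Common core of the two kinds of faces. \<open>a'\<close> and \<open>b'\<close> are
  opposite corners of the face, and \<open>L1\<close>, \<open>L2\<close> are chains on the boundary
  of its thickened rectangle in coordinate \<open>i\<close>. \<open>L1\<close> avoids the projection
  of \<open>N1\<close> and \<open>L2\<close> that of \<open>N2\<close>, so the partial Cauchy
  integrals are holomorphic on boxes that need not lie in \<open>W\<close>. The margin
  \<open>2 * \<epsilon>\<close> leaves an open convex neighbourhood of the closed rectangle for
  Cauchy's formula.\<close>

lemma cousin_split_rectangle:
  fixes a b a' b' :: "complex ^ 'n"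
  assumes "\<epsilon> > 0" and G: "G holomorphic_cn_on W" and W: "box (a' - (2 * \<epsilon>) *\<^sub>R One) (b' + (2 * \<epsilon>) *\<^sub>R One) \<subseteq> W"
    and eq: "\<And>j. j \<noteq> i \<Longrightarrow> a' $ j = a $ j \<and> b' $ j = b $ j"
    and seg1: "\<And>u v. (u, v) \<in> set L1 \<Longrightarrow> closed_segment u v \<subseteq>
      cbox (a' $ i - Complex \<epsilon> \<epsilon>) (b' $ i + Complex \<epsilon> \<epsilon>) - box (a $ i - Complex \<epsilon> \<epsilon>) (b' $ i + Complex \<epsilon> \<epsilon>)"
    and seg2: "\<And>u v. (u, v) \<in> set L2 \<Longrightarrow> closed_segment u v \<subseteq>
      cbox (a' $ i - Complex \<epsilon> \<epsilon>) (b' $ i + Complex \<epsilon> \<epsilon>) - box (a' $ i - Complex \<epsilon> \<epsilon>) (b $ i + Complex \<epsilon> \<epsilon>)"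
    and cauchy: "\<And>g z. g holomorphic_on box (a' $ i - Complex (2 * \<epsilon>) (2 * \<epsilon>)) (b' $ i + Complex (2 * \<epsilon>) (2 * \<epsilon>)) \<Longrightarrow>
      z \<in> box (a' $ i - Complex \<epsilon> \<epsilon>) (b' $ i + Complex \<epsilon> \<epsilon>) \<Longrightarrow>
      2 * pi * \<i> * g z =
        (\<Sum>(u, v)\<leftarrow>L1. contour_integral (linepath u v) (\<lambda>\<zeta>. g \<zeta> / (\<zeta> - z))) +
        (\<Sum>(u, v)\<leftarrow>L2. contour_integral (linepath u v) (\<lambda>\<zeta>. g \<zeta> / (\<zeta> - z)))"
  defines "N1 \<equiv> box (a - \<epsilon> *\<^sub>R One) (b' + \<epsilon> *\<^sub>R One)" and "N2 \<equiv> box (a' - \<epsilon> *\<^sub>R One) (b + \<epsilon> *\<^sub>R One)"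
  shows "\<exists>G1 G2. G1 holomorphic_cn_on N1 \<and> G2 holomorphic_cn_on N2 \<and> (\<forall>x\<in>N1 \<inter> N2. G x = G1 x + G2 x)"
proof -
  note nth = scaleR_One_complex_vec_nth vector_add_component vector_minus_component
  have N1: "x \<in> N1 \<longleftrightarrow> (\<forall>j. x $ j \<in> box (a $ j - Complex \<epsilon> \<epsilon>) (b' $ j + Complex \<epsilon> \<epsilon>))" for x
    by (simp only: N1_def mem_box_complex_vec nth)
  have N2: "x \<in> N2 \<longleftrightarrow> (\<forall>j. x $ j \<in> box (a' $ j - Complex \<epsilon> \<epsilon>) (b $ j + Complex \<epsilon> \<epsilon>))" for x
    by (simp only: N2_def mem_box_complex_vec nth)
  let ?S = "box (a' $ i - Complex (2 * \<epsilon>) (2 * \<epsilon>)) (b' $ i + Complex (2 * \<epsilon>) (2 * \<epsilon>))"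
  have enl: "cbox (p - Complex \<epsilon> \<epsilon>) (q + Complex \<epsilon> \<epsilon>) \<subseteq> box (p - Complex (2 * \<epsilon>) (2 * \<epsilon>)) (q + Complex (2 * \<epsilon>) (2 * \<epsilon>))" for p q
    using \<open>\<epsilon> > 0\<close> by (auto simp: in_box_complex_iff in_cbox_complex_iff)
  \<comment> \<open>In the coordinates other than \<open>i\<close>, the boxes \<open>N1\<close> and
    \<open>N2\<close> have the same extent as the thickened face, so only coordinate
    \<open>i\<close> has to be moved into \<open>?S\<close>.\<close>
  have inW: "x + axis i (\<zeta> - x $ i) \<in> W" if "x \<in> N1 \<or> x \<in> N2" "\<zeta> \<in> ?S" for x \<zeta>
  proof -
    have "(x + axis i (\<zeta> - x $ i)) $ j \<in> box (a' $ j - Complex (2 * \<epsilon>) (2 * \<epsilon>)) (b' $ j + Complex (2 * \<epsilon>) (2 * \<epsilon>))" for j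
    proof (cases "j = i")
      case True
      then show ?thesis using that(2) by (simp add: axis_def)
    next
      case False
      then have "(x + axis i (\<zeta> - x $ i)) $ j = x $ j" by (simp add: axis_def)
      moreover have "x $ j \<in> box (a' $ j - Complex \<epsilon> \<epsilon>) (b' $ j + Complex \<epsilon> \<epsilon>)"
        using that(1) eq[OF False] N1[of x] N2[of x] by metis
      ultimately show ?thesis using enl box_subset_cbox by fastforce
    qed
    then have "x + axis i (\<zeta> - x $ i) \<in> box (a' - (2 * \<epsilon>) *\<^sub>R One) (b' + (2 * \<epsilon>) *\<^sub>R One)"
      by (simp only: mem_box_complex_vec nth) simp
    with W show ?thesis by blast
  qed
  define H where "H L x = (\<Sum>(u, v)\<leftarrow>L. contour_integral (linepath u v) (\<lambda>\<zeta>. G (x + axis i (\<zeta> - x $ i)) / (\<zeta> - x $ i)))" for L x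
  have hol: "H L holomorphic_cn_on N"
    if "open N" and sub: "\<And>x. x \<in> N \<Longrightarrow> x \<in> N1 \<or> x \<in> N2" and R: "\<And>x. x \<in> N \<Longrightarrow> x $ i \<in> R"
      and L: "\<And>u v. (u, v) \<in> set L \<Longrightarrow> closed_segment u v \<subseteq> cbox (a' $ i - Complex \<epsilon> \<epsilon>) (b' $ i + Complex \<epsilon> \<epsilon>) - R" for L N R
    using L
  proof (induction L)
    case Nil
    then show ?case by (simp add: H_def)
  next
    case (Cons p L)
    obtain u v where p: "p = (u, v)" by force
    have "(\<lambda>x. contour_integral (linepath u v) (\<lambda>\<zeta>. G (x + axis i (\<zeta> - x $ i)) / (\<zeta> - x $ i))) holomorphic_cn_on N"
    proof (rule holomorphic_cn_on_cauchy_segment[OF \<open>open N\<close> G])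
      show "x + axis i (\<zeta> - x $ i) \<in> W" if "x \<in> N" "\<zeta> \<in> closed_segment u v" for x \<zeta>
        by (rule inW[OF sub[OF that(1)]]) (use Cons.prems[of u v] enl p that(2) in auto)
      show "x $ i \<notin> closed_segment u v" if "x \<in> N" for x
        using Cons.prems[of u v] p R[OF that] by auto
    qed
    moreover have "H L holomorphic_cn_on N" using Cons by simp
    ultimately have "(\<lambda>x. contour_integral (linepath u v) (\<lambda>\<zeta>. G (x + axis i (\<zeta> - x $ i)) / (\<zeta> - x $ i)) + H L x) holomorphic_cn_on N"
      by (rule holomorphic_cn_on_add)
    then show ?case by (simp add: H_def p)
  qed
  have H1: "H L1 holomorphic_cn_on N1"
    by (rule hol[OF _ _ _ seg1]) (auto simp: N1 N1_def[symmetric] open_box[of "a - \<epsilon> *\<^sub>R One" "b' + \<epsilon> *\<^sub>R One", folded N1_def])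
  have H2: "H L2 holomorphic_cn_on N2"
    by (rule hol[OF _ _ _ seg2]) (auto simp: N2 open_box[of "a' - \<epsilon> *\<^sub>R One" "b + \<epsilon> *\<^sub>R One", folded N2_def])
  have sum: "2 * pi * \<i> * G x = H L1 x + H L2 x" if x: "x \<in> N1 \<inter> N2" for x
  proof -
    let ?g = "\<lambda>\<zeta>. G (x + axis i (\<zeta> - x $ i))"
    have shift: "x + axis i (\<zeta> - x $ i) = x - axis i (x $ i) + axis i \<zeta>" for \<zeta>
      by (auto simp: vec_eq_iff axis_def)
    have "?g holomorphic_on ?S"
      unfolding shift by (rule holomorphic_on_axis_slice[OF G]) (use inW[of x] x shift in auto)
    moreover have "x $ i \<in> box (a' $ i - Complex \<epsilon> \<epsilon>) (b' $ i + Complex \<epsilon> \<epsilon>)"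
      using x by (auto simp: N1 N2 in_box_complex_iff)
    ultimately have "2 * pi * \<i> * ?g (x $ i) = H L1 x + H L2 x"
      unfolding H_def by (rule cauchy)
    moreover have "x + axis i (x $ i - x $ i) = x" by (simp add: vec_eq_iff axis_def)
    ultimately show ?thesis by (simp only:)
  qed
  let ?c = "1 / (2 * pi * \<i>)"
  have "(\<lambda>x. ?c * H L1 x) holomorphic_cn_on N1" "(\<lambda>x. ?c * H L2 x) holomorphic_cn_on N2"
    by (intro holomorphic_cn_on_mult holomorphic_cn_on_const H1 H2)+
  moreover have "\<forall>x\<in>N1 \<inter> N2. G x = ?c * H L1 x + ?c * H L2 x"
  proof
    fix x assume "x \<in> N1 \<inter> N2"
    from sum[OF this] have "?c * (2 * pi * \<i> * G x) = ?c * (H L1 x + H L2 x)" by simp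
    then show "G x = ?c * H L1 x + ?c * H L2 x" by (simp add: distrib_left field_simps)
  qed
  ultimately show ?thesis by blast
qed

text \<open>The function \<open>G\<close> is known only near the slice of the box at height
  \<open>c\<close>, yet each summand has to be holomorphic near a whole half of the box.\<close>

lemma cousin_split:
  fixes a b :: "complex ^ 'n"
  assumes "e \<in> Basis" "a \<bullet> e \<le> c" "c \<le> b \<bullet> e" and ab: "\<And>k. k \<in> Basis \<Longrightarrow> a \<bullet> k \<le> b \<bullet> k"
    and "open W" "cbox a b \<inter> {x. x \<bullet> e = c} \<subseteq> W" "G holomorphic_cn_on W"
  obtains N1 N2 G1 G2 where "open N1" "open N2" "cbox a b \<inter> {x. x \<bullet> e \<le> c} \<subseteq> N1"
    "cbox a b \<inter> {x. c \<le> x \<bullet> e} \<subseteq> N2" "N1 \<inter> N2 \<subseteq> W" "G1 holomorphic_cn_on N1" "G2 holomorphic_cn_on N2"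
    "\<And>x. x \<in> N1 \<inter> N2 \<Longrightarrow> G x = G1 x + G2 x"
proof -
  obtain i u where e: "e = axis i u" "u = 1 \<or> u = \<i>"
    using assms(1) by (auto simp: Basis_vec_def Basis_complex_def)
  \<comment> \<open>Moving \<open>a\<close> and \<open>b\<close> along \<open>e\<close> to height
    \<open>c\<close> gives the corners of the slice.\<close>
  define a' where "a' = a + (c - a \<bullet> e) *\<^sub>R e"
  define b' where "b' = b + (c - b \<bullet> e) *\<^sub>R e"
  have a'k: "a' \<bullet> k = (if k = e then c else a \<bullet> k)" and b'k: "b' \<bullet> k = (if k = e then c else b \<bullet> k)" if "k \<in> Basis" for k
    using that assms(1) by (auto simp: a'_def b'_def inner_add_left inner_Basis)
  have "cbox a' b' \<subseteq> W"
  proof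
    fix x assume x: "x \<in> cbox a' b'"
    have "a \<bullet> k \<le> x \<bullet> k \<and> x \<bullet> k \<le> b \<bullet> k" if "k \<in> Basis" for k
      using x that assms(2,3) a'k[OF that] b'k[OF that] by (cases "k = e") (force simp: mem_box)+
    moreover have "x \<bullet> e = c" using x assms(1) a'k[of e] b'k[of e] by (force simp: mem_box)
    ultimately show "x \<in> W" using assms(6) by (auto simp: mem_box)
  qed
  moreover have "a' \<bullet> k \<le> b' \<bullet> k" if "k \<in> Basis" for k
    using a'k[OF that] b'k[OF that] ab[OF that] by auto
  ultimately obtain \<epsilon>2 where \<epsilon>2: "\<epsilon>2 > 0" "box (a' - \<epsilon>2 *\<^sub>R One) (b' + \<epsilon>2 *\<^sub>R One) \<subseteq> W"
    using compact_box_enlargement[of a' b' W] \<open>open W\<close> by metis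
  define \<epsilon> where "\<epsilon> = \<epsilon>2 / 2"
  have \<epsilon>: "\<epsilon> > 0" "box (a' - (2 * \<epsilon>) *\<^sub>R One) (b' + (2 * \<epsilon>) *\<^sub>R One) \<subseteq> W"
    using \<epsilon>2 by (auto simp: \<epsilon>_def)
  define N1 where "N1 = box (a - \<epsilon> *\<^sub>R One) (b' + \<epsilon> *\<^sub>R One)"
  define N2 where "N2 = box (a' - \<epsilon> *\<^sub>R One) (b + \<epsilon> *\<^sub>R One)"
  have cover1: "cbox a b \<inter> {x. x \<bullet> e \<le> c} \<subseteq> N1" and cover2: "cbox a b \<inter> {x. c \<le> x \<bullet> e} \<subseteq> N2"
    using \<epsilon>(1) by (fastforce simp: N1_def N2_def mem_box inner_diff_left inner_add_left a'k b'k)+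
  have "N1 \<inter> N2 \<subseteq> box (a' - (2 * \<epsilon>) *\<^sub>R One) (b' + (2 * \<epsilon>) *\<^sub>R One)"
  proof
    fix x assume x: "x \<in> N1 \<inter> N2"
    have "(a' - (2 * \<epsilon>) *\<^sub>R One) \<bullet> k < x \<bullet> k \<and> x \<bullet> k < (b' + (2 * \<epsilon>) *\<^sub>R One) \<bullet> k" if k: "k \<in> Basis" for k
    proof -
      have "(a' - \<epsilon> *\<^sub>R One) \<bullet> k < x \<bullet> k \<and> x \<bullet> k < (b' + \<epsilon> *\<^sub>R One) \<bullet> k"
        using x k by (auto simp: N1_def N2_def mem_box)
      then show ?thesis using \<epsilon>(1) k by (auto simp: inner_diff_left inner_add_left)
    qed
    then show "x \<in> box (a' - (2 * \<epsilon>) *\<^sub>R One) (b' + (2 * \<epsilon>) *\<^sub>R One)" by (simp add: mem_box)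
  qed
  then have "N1 \<inter> N2 \<subseteq> W" using \<epsilon>(2) by blast
  have nth: "a' $ j = a $ j + axis i ((c - a \<bullet> e) *\<^sub>R u) $ j" "b' $ j = b $ j + axis i ((c - b \<bullet> e) *\<^sub>R u) $ j" for j
    by (auto simp: a'_def b'_def e(1) axis_def)
  have other: "a' $ j = a $ j \<and> b' $ j = b $ j" if "j \<noteq> i" for j
    using that by (auto simp: nth axis_def)
  have ae: "x \<bullet> e = x $ i \<bullet> u" for x by (simp add: e(1) inner_axis)
  have abi: "Re (a $ i) \<le> Re (b $ i)" "Im (a $ i) \<le> Im (b $ i)"
    using ab[of "axis i 1"] ab[of "axis i \<i>"] by (auto simp: Basis_vec_def Basis_complex_def inner_axis)
  \<comment> \<open>The real basis vector \<open>e\<close> is 1 or \<open>\<i>\<close> times a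
    complex unit vector; accordingly the rectangle is cut into right and left or into upper and
    lower chains.\<close>
  have "\<exists>G1 G2. G1 holomorphic_cn_on N1 \<and> G2 holomorphic_cn_on N2 \<and> (\<forall>x\<in>N1 \<inter> N2. G x = G1 x + G2 x)"
    using e(2)
  proof
    assume u: "u = 1"
    have ai: "a' $ i = Complex c (Im (a $ i))" "b' $ i = Complex c (Im (b $ i))"
      and c: "Re (a $ i) \<le> c" "c \<le> Re (b $ i)"
      using assms(2,3) ae by (auto simp: nth u complex_eq_iff)
    let ?a1 = "a' $ i - Complex \<epsilon> \<epsilon>" and ?a3 = "b' $ i + Complex \<epsilon> \<epsilon>"
    have a13: "Re ?a1 < c" "c < Re ?a3" "Im ?a1 < Im ?a3"
      using ai abi \<epsilon>(1) by auto
    show ?thesis unfolding N1_def N2_def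
    proof (rule cousin_split_rectangle[OF \<epsilon>(1) assms(7) \<epsilon>(2) other])
      fix g z
      assume "g holomorphic_on box (a' $ i - Complex (2 * \<epsilon>) (2 * \<epsilon>)) (b' $ i + Complex (2 * \<epsilon>) (2 * \<epsilon>))"
        and "z \<in> box ?a1 ?a3"
      from contour_integral_rectangle_split_Re[OF a13 convex_box(2) open_box _ this]
      show "2 * pi * \<i> * g z =
        (\<Sum>(u, v)\<leftarrow>[(Complex c (Im ?a1), Complex (Re ?a3) (Im ?a1)), (Complex (Re ?a3) (Im ?a1), ?a3), (?a3, Complex c (Im ?a3))]. contour_integral (linepath u v) (\<lambda>\<zeta>. g \<zeta> / (\<zeta> - z))) +
        (\<Sum>(u, v)\<leftarrow>[(Complex c (Im ?a3), Complex (Re ?a1) (Im ?a3)), (Complex (Re ?a1) (Im ?a3), ?a1), (?a1, Complex c (Im ?a1))]. contour_integral (linepath u v) (\<lambda>\<zeta>. g \<zeta> / (\<zeta> - z)))"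
        using \<epsilon>(1) by (auto simp: subset_iff in_box_complex_iff in_cbox_complex_iff)
    qed (use ai abi c \<epsilon>(1) in \<open>auto simp: closed_segment_same_Re closed_segment_same_Im closed_segment_eq_real_ivl
           in_box_complex_iff in_cbox_complex_iff split: if_splits\<close>)
  next
    assume u: "u = \<i>"
    have ai: "a' $ i = Complex (Re (a $ i)) c" "b' $ i = Complex (Re (b $ i)) c"
      and c: "Im (a $ i) \<le> c" "c \<le> Im (b $ i)"
      using assms(2,3) ae by (auto simp: nth u complex_eq_iff)
    let ?a1 = "a' $ i - Complex \<epsilon> \<epsilon>" and ?a3 = "b' $ i + Complex \<epsilon> \<epsilon>"
    have a13: "Re ?a1 < Re ?a3" "Im ?a1 < c" "c < Im ?a3"
      using ai abi \<epsilon>(1) by auto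
    show ?thesis unfolding N1_def N2_def
    proof (rule cousin_split_rectangle[OF \<epsilon>(1) assms(7) \<epsilon>(2) other])
      fix g z
      assume "g holomorphic_on box (a' $ i - Complex (2 * \<epsilon>) (2 * \<epsilon>)) (b' $ i + Complex (2 * \<epsilon>) (2 * \<epsilon>))"
        and "z \<in> box ?a1 ?a3"
      from contour_integral_rectangle_split_Im[OF a13 convex_box(2) open_box _ this]
      show "2 * pi * \<i> * g z =
        (\<Sum>(u, v)\<leftarrow>[(Complex (Re ?a3) c, ?a3), (?a3, Complex (Re ?a1) (Im ?a3)), (Complex (Re ?a1) (Im ?a3), Complex (Re ?a1) c)]. contour_integral (linepath u v) (\<lambda>\<zeta>. g \<zeta> / (\<zeta> - z))) +
        (\<Sum>(u, v)\<leftarrow>[(Complex (Re ?a1) c, ?a1), (?a1, Complex (Re ?a3) (Im ?a1)), (Complex (Re ?a3) (Im ?a1), Complex (Re ?a3) c)]. contour_integral (linepath u v) (\<lambda>\<zeta>. g \<zeta> / (\<zeta> - z)))"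
        using \<epsilon>(1) by (auto simp: subset_iff in_box_complex_iff in_cbox_complex_iff)
    qed (use ai abi c \<epsilon>(1) in \<open>auto simp: closed_segment_same_Re closed_segment_same_Im closed_segment_eq_real_ivl
           in_box_complex_iff in_cbox_complex_iff split: if_splits\<close>)
  qed
  then obtain G1 G2 where "G1 holomorphic_cn_on N1" "G2 holomorphic_cn_on N2" "\<And>x. x \<in> N1 \<inter> N2 \<Longrightarrow> G x = G1 x + G2 x"
    by blast
  moreover have "open N1" "open N2" by (auto simp: N1_def N2_def open_box)
  ultimately show ?thesis using that cover1 cover2 \<open>N1 \<inter> N2 \<subseteq> W\<close> by blast
qed

section \<open>The additive Cousin problem for a principal divisor\<close>

text \<open>A global section of the quotient sheaf O/kO, represented near \<open>p\<close> by
  \<open>F p\<close>; equivalently, Cousin data \<open>F p / k\<close>. One neighbourhood for each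
  point makes \<open>V\<close> a gauge, and consistency compares the germ at \<open>p\<close> only
  with the representative chosen at \<open>p\<close>. The point \<open>w\<close> certifies that
  \<open>k\<close> is not identically zero.\<close>

locale principal_cousin =
  fixes k :: "complex ^ 'n \<Rightarrow> complex" and w :: "complex ^ 'n"
    and F :: "complex ^ 'n \<Rightarrow> complex ^ 'n \<Rightarrow> complex" and V :: "complex ^ 'n \<Rightarrow> (complex ^ 'n) set"
  assumes k: "k holomorphic_cn_on UNIV" "k w \<noteq> 0"
    and open_V: "open (V x)" and mem_V: "x \<in> V x" and hol_F: "F x holomorphic_cn_on V x"
    and compatible: "p \<in> V x \<Longrightarrow> germ_dvd k (\<lambda>y. F x y - F p y) p"
begin

text \<open>A lift over \<open>N\<close> of the section from O/kO to O.\<close>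

definition sol :: "(complex ^ 'n \<Rightarrow> complex) \<Rightarrow> (complex ^ 'n) set \<Rightarrow> bool"
  where "sol \<Lambda> N \<longleftrightarrow> open N \<and> \<Lambda> holomorphic_cn_on N \<and> (\<forall>p\<in>N. germ_dvd k (\<lambda>y. \<Lambda> y - F p y) p)"

lemma sol_subset: "sol \<Lambda> N \<Longrightarrow> open N' \<Longrightarrow> N' \<subseteq> N \<Longrightarrow> sol \<Lambda> N'"
  unfolding sol_def by (blast intro: holomorphic_cn_on_subset)

lemma sol_local: "sol (F x) (V x)"
  unfolding sol_def using open_V hol_F compatible by blast

lemma sol_cong:
  assumes "sol \<Lambda> N" "\<And>y. y \<in> N \<Longrightarrow> \<Lambda> y = \<Lambda>' y"
  shows "sol \<Lambda>' N"
  unfolding sol_def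
proof (intro conjI ballI)
  show "open N" using assms(1) by (simp add: sol_def)
  show "\<Lambda>' holomorphic_cn_on N"
    using assms by (auto simp: sol_def intro: holomorphic_cn_on_cong)
  fix p assume p: "p \<in> N"
  then have "germ_dvd k (\<lambda>y. \<Lambda> y - F p y) p" using assms(1) by (simp add: sol_def)
  then show "germ_dvd k (\<lambda>y. \<Lambda>' y - F p y) p"
    by (rule germ_dvd_cong[OF _ \<open>open N\<close> p]) (simp add: assms(2))
qed

lemma sol_glue:
  assumes "sol \<Lambda>1 N1" "sol \<Lambda>2 N2" "\<And>y. y \<in> N1 \<inter> N2 \<Longrightarrow> \<Lambda>1 y = \<Lambda>2 y"
  shows "\<exists>\<Lambda>. sol \<Lambda> (N1 \<union> N2)"
proof -
  define \<Lambda> where "\<Lambda> y = (if y \<in> N1 then \<Lambda>1 y else \<Lambda>2 y)" for y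
  have "sol \<Lambda> N1" "sol \<Lambda> N2"
    using assms(3) by (auto intro!: sol_cong[OF assms(1)] sol_cong[OF assms(2)] simp: \<Lambda>_def)
  then have "sol \<Lambda> (N1 \<union> N2)"
    unfolding sol_def holomorphic_cn_on_def by blast
  then show ?thesis by blast
qed

text \<open>The representatives \<open>F p\<close> cancel, leaving germwise divisibility by
  \<open>k\<close>, which globalizes because quotients are unique.\<close>

lemma sol_diff:
  assumes "sol \<Lambda> N" "sol \<Lambda>' N'"
  shows "\<exists>G. G holomorphic_cn_on N \<inter> N' \<and> (\<forall>y\<in>N \<inter> N'. \<Lambda> y - \<Lambda>' y = k y * G y)"
proof (rule germ_dvd_imp_global[OF k])
  show "open (N \<inter> N')" using assms by (auto simp: sol_def)
  fix p assume "p \<in> N \<inter> N'"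
  then have "germ_dvd k (\<lambda>y. \<Lambda> y - F p y) p" "germ_dvd k (\<lambda>y. \<Lambda>' y - F p y) p"
    using assms by (auto simp: sol_def)
  then have "germ_dvd k (\<lambda>y. (\<Lambda> y - F p y) - (\<Lambda>' y - F p y)) p"
    by (rule germ_dvd_diff)
  then show "germ_dvd k (\<lambda>y. \<Lambda> y - \<Lambda>' y) p" by simp
qed

lemma sol_modify:
  assumes "sol \<Lambda> N" "G holomorphic_cn_on N'" "open N'"
  shows "sol (\<lambda>y. \<Lambda> y + k y * G y) (N \<inter> N')"
  unfolding sol_def
proof (intro conjI ballI)
  show "open (N \<inter> N')" using assms by (auto simp: sol_def)
  show "(\<lambda>y. \<Lambda> y + k y * G y) holomorphic_cn_on N \<inter> N'"
    using assms k(1) by (intro holomorphic_cn_on_add holomorphic_cn_on_mult)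
      (auto simp: sol_def intro: holomorphic_cn_on_subset)
  fix p assume p: "p \<in> N \<inter> N'"
  then have "germ_dvd k (\<lambda>y. \<Lambda> y - F p y) p" "germ_dvd k (\<lambda>y. k y * G y) p"
    using assms germ_dvdI[of N' p G "\<lambda>y. k y * G y" k] by (auto simp: sol_def)
  then have "germ_dvd k (\<lambda>y. (\<Lambda> y - F p y) + k y * G y) p"
    by (rule germ_dvd_add)
  then show "germ_dvd k (\<lambda>y. \<Lambda> y + k y * G y - F p y) p" by (simp add: algebra_simps)
qed

text \<open>Since \<open>\<Lambda>1 - \<Lambda>2 = k * (G1 + G2)\<close> near the cut,
  \<open>\<Lambda>1 - k * G1\<close> and \<open>\<Lambda>2 + k * G2\<close> agree there, and adding
  multiples of \<open>k\<close> keeps them solutions.\<close>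

lemma sol_halves:
  assumes "e \<in> Basis" "a \<bullet> e \<le> c" "c \<le> b \<bullet> e" and ab: "\<And>k. k \<in> Basis \<Longrightarrow> a \<bullet> k \<le> b \<bullet> k"
    and "sol \<Lambda>1 D1" "cbox a b \<inter> {x. x \<bullet> e \<le> c} \<subseteq> D1"
    and "sol \<Lambda>2 D2" "cbox a b \<inter> {x. x \<bullet> e \<ge> c} \<subseteq> D2"
  shows "\<exists>\<Lambda> N. sol \<Lambda> N \<and> cbox a b \<subseteq> N"
proof -
  obtain G where G: "G holomorphic_cn_on D1 \<inter> D2" "\<And>y. y \<in> D1 \<inter> D2 \<Longrightarrow> \<Lambda>1 y - \<Lambda>2 y = k y * G y"
    using sol_diff[OF assms(5,7)] by blast
  have "open (D1 \<inter> D2)" using assms(5,7) by (auto simp: sol_def)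
  moreover have "cbox a b \<inter> {x. x \<bullet> e = c} \<subseteq> D1 \<inter> D2" using assms(6,8) by auto
  ultimately obtain N1 N2 G1 G2 where N: "open N1" "open N2" "cbox a b \<inter> {x. x \<bullet> e \<le> c} \<subseteq> N1"
    "cbox a b \<inter> {x. c \<le> x \<bullet> e} \<subseteq> N2" "N1 \<inter> N2 \<subseteq> D1 \<inter> D2" "G1 holomorphic_cn_on N1" "G2 holomorphic_cn_on N2"
    "\<And>x. x \<in> N1 \<inter> N2 \<Longrightarrow> G x = G1 x + G2 x"
    using cousin_split[OF assms(1,2,3) ab _ _ G(1)] by metis
  have s1: "sol (\<lambda>y. \<Lambda>1 y + k y * (- G1 y)) (D1 \<inter> N1)"
    by (intro sol_modify[OF assms(5)] holomorphic_cn_on_uminus N)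
  have s2: "sol (\<lambda>y. \<Lambda>2 y + k y * G2 y) (D2 \<inter> N2)"
    by (intro sol_modify[OF assms(7)] N)
  have "\<exists>\<Lambda>. sol \<Lambda> (D1 \<inter> N1 \<union> D2 \<inter> N2)"
  proof (rule sol_glue[OF s1 s2])
    fix y assume "y \<in> D1 \<inter> N1 \<inter> (D2 \<inter> N2)"
    then show "\<Lambda>1 y + k y * (- G1 y) = \<Lambda>2 y + k y * G2 y"
      using G(2)[of y] N(8)[of y] by (auto simp: algebra_simps)
  qed
  moreover have "cbox a b \<subseteq> D1 \<inter> N1 \<union> D2 \<inter> N2"
    using assms(6,8) N(3,4) by (auto simp: subset_iff) (meson linear)+
  ultimately show ?thesis by blast
qed

text \<open>Cousin's lemma divides the box into pieces, each inside some \<open>V x\<close>. The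
  passage back from the pieces to the box is expressed by \<open>operative\<close>: only cuts by one
  hyperplane have to be examined, and the combinatorics of the division is left to
  \<open>operative.division\<close>.\<close>

lemma sol_cbox:
  assumes "box a b \<noteq> {}"
  shows "\<exists>\<Lambda> N. sol \<Lambda> N \<and> cbox a b \<subseteq> N"
proof -
  \<comment> \<open>An operative predicate takes the neutral value \<open>True\<close> on boxes
    without interior, whence the first alternative.\<close>
  define P where "P S \<longleftrightarrow> interior S = {} \<or> (\<exists>\<Lambda> N. sol \<Lambda> N \<and> S \<subseteq> N)" for S
  have mono: "P T" if "P S" "T \<subseteq> S" for S T
    using that interior_mono[of T S] unfolding P_def by blast
  interpret all: comm_monoid_set conj True by standard auto
  have op: "operative conj True P"
  proof
    show "P (cbox a b) = True" if "box a b = {}" for a b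
      using that by (simp add: P_def interior_cbox)
    fix a b :: "complex ^ 'n" and c e assume e: "e \<in> (Basis :: (complex ^ 'n) set)"
    let ?L = "cbox a b \<inter> {x. x \<bullet> e \<le> c}" and ?R = "cbox a b \<inter> {x. c \<le> x \<bullet> e}"
    have "P (cbox a b)" if "P ?L" "P ?R"
    proof (cases "box a b = {}")
      case True
      then show ?thesis by (simp add: P_def interior_cbox)
    next
      case False
      then have ab: "\<And>i. i \<in> Basis \<Longrightarrow> a \<bullet> i < b \<bullet> i" by (simp add: box_ne_empty)
      \<comment> \<open>If the cut misses the interior, one of the halves is the whole box.\<close>
      consider "c \<le> a \<bullet> e" | "b \<bullet> e \<le> c" | "a \<bullet> e < c" "c < b \<bullet> e" by linarith
      then show ?thesis
      proof cases
        case 1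
        then have "cbox a b \<subseteq> ?R" using e by (force simp: mem_box)
        with that show ?thesis using mono by blast
      next
        case 2
        then have "cbox a b \<subseteq> ?L" using e by (force simp: mem_box)
        with that show ?thesis using mono by blast
      next
        case 3
        \<comment> \<open>Halves with interior exclude the first alternative of \<open>P\<close>, so
          both carry actual solutions.\<close>
        have "interior ?L \<noteq> {}" "interior ?R \<noteq> {}"
          using ab 3 e by (auto simp: interval_split interior_cbox box_ne_empty)
        with that obtain \<Lambda>1 D1 \<Lambda>2 D2 where "sol \<Lambda>1 D1" "?L \<subseteq> D1" "sol \<Lambda>2 D2" "?R \<subseteq> D2"
          unfolding P_def by meson
        from sol_halves[OF e less_imp_le[OF 3(1)] less_imp_le[OF 3(2)] less_imp_le[OF ab] this]
        show ?thesis unfolding P_def by blast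
      qed
    qed
    then show "P (cbox a b) = (P ?L \<and> P ?R)"
      using mono[of "cbox a b"] by blast
  qed
  have "gauge V" using open_V mem_V by (simp add: gauge_def)
  then obtain p where p: "p tagged_division_of cbox a b" "V fine p"
    using fine_division_exists by blast
  have "\<forall>K\<in>snd ` p. P K = True"
  proof
    fix K assume "K \<in> snd ` p"
    then obtain x where "(x, K) \<in> p" by auto
    then have "K \<subseteq> V x" using p(2) by (auto simp: fine_def)
    then show "P K = True" using sol_local[of x] unfolding P_def by blast
  qed
  then have "all.F P (snd ` p) = True" by (rule all.neutral)
  then have "P (cbox a b)"
    using operative.division[OF op division_of_tagged_division[OF p(1)]] by simp
  then show ?thesis using assms by (simp add: P_def interior_cbox)
qed

lemma sol_ball: "\<exists>\<Lambda>. sol \<Lambda> (ball 0 R)"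
proof -
  \<comment> \<open>The maximum keeps the box nondegenerate even if \<open>R\<close> is not
    positive.\<close>
  define r where "r = max R 1"
  have "(- r *\<^sub>R One) \<bullet> i < (r *\<^sub>R One) \<bullet> i" if "i \<in> (Basis :: (complex ^ 'n) set)" for i
    using that by (simp add: r_def)
  then have "box (- r *\<^sub>R One) (r *\<^sub>R One :: complex ^ 'n) \<noteq> {}"
    unfolding box_ne_empty by blast
  from sol_cbox[OF this] obtain \<Lambda> N where "sol \<Lambda> N" "cbox (- r *\<^sub>R One) (r *\<^sub>R One) \<subseteq> N" by blast
  moreover have "ball 0 R \<subseteq> cbox (- r *\<^sub>R One) (r *\<^sub>R One :: complex ^ 'n)"
  proof
    fix x :: "complex ^ 'n" assume "x \<in> ball 0 R"
    then have "\<bar>x \<bullet> i\<bar> \<le> r" if "i \<in> Basis" for i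
      using Basis_le_norm[OF that, of x] by (simp add: r_def)
    then show "x \<in> cbox (- r *\<^sub>R One) (r *\<^sub>R One)" by (auto simp: mem_box abs_le_iff) (smt (verit))
  qed
  ultimately show ?thesis by (meson open_ball order_trans sol_subset)
qed

end

section \<open>Approximation by entire functions on balls\<close>

lemma norm_vector_scalar_mult: "norm (c *s (x :: complex ^ 'n)) = norm c * norm x"
  by (simp add: norm_vec_def norm_mult L2_set_right_distrib)

text \<open>This is the homogeneous part of degree \<open>j\<close> of the Taylor expansion of
  \<open>G\<close> at 0, the coefficient of \<open>t ^ j\<close> in \<open>G (t *s x)\<close>. It
  makes sense for every \<open>x\<close>, since only small \<open>t\<close> matter; Cauchy's formula
  over a small circle gives holomorphy near a given \<open>x0\<close>.\<close>

lemma holomorphic_cn_on_homogeneous_part: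
  fixes G :: "complex ^ 'n \<Rightarrow> complex"
  assumes G: "G holomorphic_cn_on ball 0 R" and "R > 0"
  shows "(\<lambda>x. (deriv ^^ j) (\<lambda>t. G (t *s x)) 0 / fact j) holomorphic_cn_on UNIV"
proof (rule holomorphic_cn_on_local)
  fix x0 :: "complex ^ 'n"
  \<comment> \<open>This radius keeps \<open>t *s x\<close> in the ball of radius \<open>R\<close>
    whenever \<open>x\<close> is within 1 of \<open>x0\<close> and
    \<open>norm t \<le> \<rho>\<close>.\<close>
  define \<rho> where "\<rho> = R / 2 / (norm x0 + 1)"
  have *: "norm x0 + 1 > 0" by (simp add: add_nonneg_pos)
  have "a / c * c = a" if "c > 0" for a c :: real using that by simp
  from this[OF *] have "\<rho> * (norm x0 + 1) = R / 2" unfolding \<rho>_def .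
  then have \<rho>: "\<rho> > 0" "\<rho> * (norm x0 + 1) < R"
    using * \<open>R > 0\<close> by (simp_all add: \<rho>_def)
  have in_ball: "t *s x \<in> ball 0 R" if "x \<in> ball x0 1" "norm t \<le> \<rho>" for x t
  proof -
    have "norm x \<le> norm x0 + 1"
      using norm_triangle_ineq2[of x x0] that(1) by (simp add: dist_norm norm_minus_commute)
    then have "norm t * norm x \<le> \<rho> * (norm x0 + 1)"
      using that(2) \<rho>(1) by (intro mult_mono) auto
    then show ?thesis using \<rho>(2) by (simp add: norm_vector_scalar_mult)
  qed
  let ?c = "\<lambda>s. circlepath 0 \<rho> s"
  have norm_c: "norm (?c s) = \<rho>" for s using \<rho>(1) by (simp add: circlepath norm_mult)
  define \<phi> where "\<phi> x s = G (?c s *s x) / (?c s - 0) ^ Suc j * vector_derivative (circlepath 0 \<rho>) (at s)" for x s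
  have "(\<lambda>x. integral {0..1} (\<phi> x)) holomorphic_cn_on ball x0 1"
  proof (rule holomorphic_cn_on_integral[OF open_ball])
    have 1: "continuous_on (ball x0 1 \<times> {0..1}) (\<lambda>q. ?c (snd q) *s fst q)"
      unfolding vector_scalar_mult_def circlepath
      by (intro continuous_intros continuous_on_vec_lambda)
    have 2: "continuous_on (ball x0 1 \<times> {0..1}) (\<lambda>q. G (?c (snd q) *s fst q))"
      by (rule continuous_on_compose2[OF holomorphic_cn_on_imp_continuous_on[OF G] 1])
         (use in_ball norm_c in force)
    have 3: "continuous_on (ball x0 1 \<times> {0..1}) (\<lambda>q. (?c (snd q) - 0) ^ Suc j)"
      unfolding circlepath by (intro continuous_intros)
    have 4: "\<forall>q\<in>ball x0 1 \<times> {0..1}. (?c (snd q) - 0) ^ Suc j \<noteq> 0"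
      using norm_c \<rho>(1) by (metis diff_zero norm_zero order_less_irrefl power_not_zero)
    have 5: "continuous_on (ball x0 1 \<times> {0..1}) (\<lambda>q. vector_derivative (circlepath 0 \<rho>) (at (snd q)))"
      unfolding vector_derivative_circlepath by (intro continuous_intros)
    show "continuous_on (ball x0 1 \<times> {0..1}) (\<lambda>(x, s). \<phi> x s)"
      unfolding \<phi>_def case_prod_unfold
      by (intro continuous_on_mult continuous_on_divide[OF 2 3 4] 5)
    fix s :: real assume "s \<in> {0..1}"
    have "(\<lambda>x. G (0 + ?c s *s x)) holomorphic_cn_on ball x0 1"
      by (rule holomorphic_cn_on_compose_affine[OF G])
         (use in_ball norm_c in \<open>auto intro!: linearI simp: vec_eq_iff algebra_simps\<close>)
    then have "(\<lambda>x. G (?c s *s x)) holomorphic_cn_on ball x0 1" by simp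
    moreover have "?c s - 0 \<noteq> 0" using norm_c[of s] \<rho>(1) by auto
    ultimately show "(\<lambda>x. \<phi> x s) holomorphic_cn_on ball x0 1"
      unfolding \<phi>_def
      by (intro holomorphic_cn_on_mult holomorphic_cn_on_divide holomorphic_cn_on_const) auto
  qed
  then have "(\<lambda>x. 1 / (2 * pi * \<i>) * integral {0..1} (\<phi> x)) holomorphic_cn_on ball x0 1"
    by (rule holomorphic_cn_on_mult[OF holomorphic_cn_on_const])
  moreover have "1 / (2 * pi * \<i>) * integral {0..1} (\<phi> x) = (deriv ^^ j) (\<lambda>t. G (t *s x)) 0 / fact j"
    if x: "x \<in> ball x0 1" for x
  proof -
    have "(\<lambda>t. G (0 + t *s x)) holomorphic_on cball 0 \<rho>"
      by (rule holomorphic_on_complex_line[OF G]) (use in_ball[OF x] in auto)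
    then have hol: "(\<lambda>t. G (t *s x)) holomorphic_on cball 0 \<rho>" by simp
    have "contour_integral (circlepath 0 \<rho>) (\<lambda>t. G (t *s x) / (t - 0) ^ Suc j)
        = (2 * pi * \<i>) * (deriv ^^ j) (\<lambda>t. G (t *s x)) 0 / fact j"
      using hol \<rho>(1) by (intro Cauchy_contour_integral_circlepath holomorphic_on_imp_continuous_on)
         (auto intro: holomorphic_on_subset)
    then show ?thesis unfolding contour_integral_integral \<phi>_def by simp
  qed
  ultimately have "(\<lambda>x. (deriv ^^ j) (\<lambda>t. G (t *s x)) 0 / fact j) holomorphic_cn_on ball x0 1"
    by (rule holomorphic_cn_on_cong[OF open_ball])
  then show "\<exists>V. x0 \<in> V \<and> (\<lambda>x. (deriv ^^ j) (\<lambda>t. G (t *s x)) 0 / fact j) holomorphic_cn_on V"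
    by (intro exI[of _ "ball x0 1"] conjI) (simp_all only: centre_in_ball zero_less_one)
qed

text \<open>For \<open>norm x < r\<close> the slice \<open>t \<mapsto> G (t *s x)\<close> is
  holomorphic up to a radius \<open>\<rho> > 1\<close>, so by Cauchy's inequality its Taylor
  coefficients are dominated, uniformly in \<open>x\<close>, by a geometric series of ratio
  \<open>1 / \<rho>\<close>. The partial sums at \<open>t = 1\<close> are the approximants.\<close>

lemma holomorphic_cn_runge_ball:
  fixes G :: "complex ^ 'n \<Rightarrow> complex"
  assumes G: "G holomorphic_cn_on ball 0 R" and r: "0 < r" "r < R" and "e > 0"
  shows "\<exists>P. P holomorphic_cn_on UNIV \<and> (\<forall>x\<in>ball 0 r. norm (G x - P x) \<le> e)"
proof -
  \<comment> \<open>An intermediate radius gives a compact ball on which \<open>G\<close> is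
    bounded, and a dilation factor above 1.\<close>
  define s where "s = (r + R) / 2"
  define \<rho> where "\<rho> = s / r"
  have s: "r < s" "s < R" and \<rho>: "\<rho> > 1" "\<rho> * r = s" using r by (auto simp: s_def \<rho>_def)
  define p where "p j x = (deriv ^^ j) (\<lambda>t. G (t *s x)) 0 / fact j" for j x
  have "continuous_on (cball 0 s) G"
    by (rule continuous_on_subset[OF holomorphic_cn_on_imp_continuous_on[OF G]]) (use s in auto)
  then have "bounded (G ` cball 0 s)"
    by (intro compact_imp_bounded compact_continuous_image compact_cball)
  then obtain M where M: "\<And>y. y \<in> cball 0 s \<Longrightarrow> norm (G y) \<le> M"
    unfolding bounded_iff by blast
  have *: "(\<lambda>j. p j x) sums G x" "norm (p j x) \<le> M * (1 / \<rho>) ^ j" if x: "x \<in> ball 0 r" for x j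
  proof -
    have in_cball: "t *s x \<in> cball 0 s" if "norm t \<le> \<rho>" for t
    proof -
      have "norm t * norm x \<le> \<rho> * r" using x that \<rho>(1) by (intro mult_mono) auto
      then show ?thesis using \<rho>(2) by (simp add: norm_vector_scalar_mult)
    qed
    have "(\<lambda>t. G (0 + t *s x)) holomorphic_on cball 0 \<rho>"
      by (rule holomorphic_on_complex_line[OF G]) (use in_cball s in force)
    then have hol: "(\<lambda>t. G (t *s x)) holomorphic_on cball 0 \<rho>" by simp
    then have hol': "(\<lambda>t. G (t *s x)) holomorphic_on ball 0 \<rho>"
      by (rule holomorphic_on_subset) auto
    show "(\<lambda>j. p j x) sums G x"
      using holomorphic_power_series[OF hol', of 1] \<rho>(1) by (simp add: p_def)
    have "norm ((deriv ^^ j) (\<lambda>t. G (t *s x)) 0) \<le> fact j * M / \<rho> ^ j"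
      by (rule Cauchy_inequality[OF hol' holomorphic_on_imp_continuous_on[OF hol]])
         (use \<rho>(1) M in_cball in auto)
    then show "norm (p j x) \<le> M * (1 / \<rho>) ^ j"
      using \<rho>(1) by (simp add: p_def norm_divide field_simps)
  qed
  have "summable (\<lambda>j. M * (1 / \<rho>) ^ j)"
    using \<rho>(1) by (intro summable_mult summable_geometric) auto
  with *(2) have "uniform_limit (ball 0 r) (\<lambda>n x. \<Sum>j<n. p j x) (\<lambda>x. \<Sum>j. p j x) sequentially"
    by (rule Weierstrass_m_test)
  then have "\<forall>\<^sub>F n in sequentially. \<forall>x\<in>ball 0 r. dist (\<Sum>j<n. p j x) (\<Sum>j. p j x) < e"
    using \<open>e > 0\<close> unfolding uniform_limit_iff by blast
  then obtain n where n: "\<forall>x\<in>ball 0 r. dist (\<Sum>j<n. p j x) (\<Sum>j. p j x) < e"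
    using eventually_happens'[OF sequentially_bot] by blast
  have "(\<lambda>x. \<Sum>j<n. p j x) holomorphic_cn_on UNIV"
    unfolding p_def using r by (intro holomorphic_cn_on_sum holomorphic_cn_on_homogeneous_part[OF G]) auto
  moreover have "norm (G x - (\<Sum>j<n. p j x)) \<le> e" if "x \<in> ball 0 r" for x
    using bspec[OF n that] sums_unique[OF *(1)[OF that]] by (simp add: dist_norm norm_minus_commute)
  ultimately show ?thesis by blast
qed

context principal_cousin
begin

text \<open>Solutions on concentric balls of increasing radius, corrected by multiples of \<open>k\<close> so that
  consecutive ones become close to each other, converge to an entire solution.\<close>

theorem entire_sol: "\<exists>\<Lambda>. sol \<Lambda> UNIV"
proof -
  let ?B = "\<lambda>n :: nat. ball 0 (real n + 1) :: (complex ^ 'n) set"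
  \<comment> \<open>The bound is put on the quotient \<open>G\<close> of the difference by
    \<open>k\<close>, not on the difference: this makes the limit congruent to each
    \<open>f n\<close> modulo \<open>k\<close>. The radii \<open>n + 2\<close> and
    \<open>n + 1\<close> leave the gap that the approximation needs.\<close>
  have "\<exists>f. \<forall>n. sol (f n) (ball 0 (real n + 2)) \<and> (\<exists>G. G holomorphic_cn_on ?B n \<and>
     (\<forall>x\<in>?B n. f (Suc n) x = f n x + k x * G x \<and> norm (G x) \<le> (1 / 2) ^ n))"
  proof (rule dependent_nat_choice)
    show "\<exists>\<Lambda>. sol \<Lambda> (ball 0 (real 0 + 2))" by (rule sol_ball)
    fix \<Lambda> :: "complex ^ 'n \<Rightarrow> complex" and n :: nat assume \<Lambda>: "sol \<Lambda> (ball 0 (real n + 2))"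
    obtain \<Lambda>0 where \<Lambda>0: "sol \<Lambda>0 (ball 0 (real (Suc n) + 2))" using sol_ball by blast
    obtain G0 where "G0 holomorphic_cn_on ball 0 (real (Suc n) + 2) \<inter> ball 0 (real n + 2)"
      and G0: "\<forall>y\<in>ball 0 (real (Suc n) + 2) \<inter> ball 0 (real n + 2). \<Lambda>0 y - \<Lambda> y = k y * G0 y"
      using sol_diff[OF \<Lambda>0 \<Lambda>] by blast
    then have G0_hol: "G0 holomorphic_cn_on ball 0 (real n + 2)"
      by (auto intro: holomorphic_cn_on_subset)
    then obtain P where P: "P holomorphic_cn_on UNIV" "\<forall>x\<in>?B n. norm (G0 x - P x) \<le> (1 / 2) ^ n"
      using holomorphic_cn_runge_ball[of G0 "real n + 2" "real n + 1" "(1 / 2) ^ n"] by auto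
    \<comment> \<open>\<open>P\<close> is entire, so subtracting \<open>k * P\<close> does not
      shrink the ball on which \<Lambda>0 is a solution.\<close>
    have "sol (\<lambda>y. \<Lambda>0 y + k y * (- P y)) (ball 0 (real (Suc n) + 2) \<inter> UNIV)"
      by (rule sol_modify[OF \<Lambda>0 holomorphic_cn_on_uminus[OF P(1)]]) simp
    moreover have "(\<lambda>x. G0 x - P x) holomorphic_cn_on ?B n"
      using G0_hol P(1) by (intro holomorphic_cn_on_diff) (auto intro: holomorphic_cn_on_subset)
    moreover have "\<Lambda>0 x + k x * (- P x) = \<Lambda> x + k x * (G0 x - P x)" if "x \<in> ?B n" for x
      using bspec[OF G0, of x] that by (simp add: algebra_simps)
    ultimately show "\<exists>\<Lambda>'. sol \<Lambda>' (ball 0 (real (Suc n) + 2)) \<and> (\<exists>G. G holomorphic_cn_on ?B n \<and>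
       (\<forall>x\<in>?B n. \<Lambda>' x = \<Lambda> x + k x * G x \<and> norm (G x) \<le> (1 / 2) ^ n))"
      using P(2) by (intro exI[of _ "\<lambda>y. \<Lambda>0 y + k y * (- P y)"] conjI exI[of _ "\<lambda>x. G0 x - P x"]) auto
  qed
  then obtain f where f: "\<And>n. sol (f n) (ball 0 (real n + 2))"
    and "\<forall>n. \<exists>G. G holomorphic_cn_on ?B n \<and>
     (\<forall>x\<in>?B n. f (Suc n) x = f n x + k x * G x \<and> norm (G x) \<le> (1 / 2) ^ n)" by blast
  then obtain G where G: "\<And>n. G n holomorphic_cn_on ?B n"
    "\<And>n x. x \<in> ?B n \<Longrightarrow> f (Suc n) x = f n x + k x * G n x" "\<And>n x. x \<in> ?B n \<Longrightarrow> norm (G n x) \<le> (1 / 2) ^ n"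
    by metis
  \<comment> \<open>\<open>T N\<close> collects the corrections from index \<open>N\<close> on; on
    the ball of radius \<open>N + 1\<close> the limit is \<open>f N + k * T N\<close>.\<close>
  define T where "T N x = (\<Sum>j. G (N + j) x)" for N x
  \<comment> \<open>The pointwise limit does not refer to \<open>N\<close>, so the descriptions on
    different balls concern one function.\<close>
  define \<Lambda> where "\<Lambda> x = lim (\<lambda>m. f m x)" for x
  have "sol \<Lambda> (?B N)" for N
  proof -
    have mono: "x \<in> ?B (N + j)" if "x \<in> ?B N" for x j using that by auto
    have summ: "summable (\<lambda>j. (1 / 2 :: real) ^ (N + j))"
      by (simp add: power_add summable_mult)
    have bound: "norm (G (N + j) x) \<le> (1 / 2) ^ (N + j)" if "x \<in> ?B N" for x j
      by (rule G(3)[OF mono[OF that]])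
    have ulim: "uniform_limit (?B N) (\<lambda>n x. \<Sum>j<n. G (N + j) x) (T N) sequentially"
      unfolding T_def by (rule Weierstrass_m_test[OF bound summ])
    have "T N holomorphic_cn_on ?B N"
    proof (rule holomorphic_cn_on_uniform_limit[OF open_ball _ ulim])
      show "(\<lambda>x. \<Sum>j<n. G (N + j) x) holomorphic_cn_on ?B N" for n
        by (intro holomorphic_cn_on_sum holomorphic_cn_on_subset[OF G(1)]) auto
    qed
    from sol_modify[OF f[of N] this open_ball]
    have "sol (\<lambda>y. f N y + k y * T N y) (?B N)" by (rule sol_subset) auto
    then show ?thesis
    proof (rule sol_cong)
      fix x assume x: "x \<in> ?B N"
      have eq: "f (N + m) x = f N x + k x * (\<Sum>j<m. G (N + j) x)" for m
        by (induction m) (use G(2)[OF mono[OF x]] in \<open>auto simp: algebra_simps\<close>)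
      have "(\<lambda>m. f N x + k x * (\<Sum>j<m. G (N + j) x)) \<longlonglongrightarrow> f N x + k x * T N x"
        by (intro tendsto_intros tendsto_uniform_limitI[OF ulim x])
      then have "(\<lambda>m. f (N + m) x) \<longlonglongrightarrow> f N x + k x * T N x"
        by (simp only: eq)
      then have "(\<lambda>m. f m x) \<longlonglongrightarrow> f N x + k x * T N x"
        by (subst (asm) add.commute) (rule LIMSEQ_offset)
      then show "f N x + k x * T N x = \<Lambda> x" by (simp add: \<Lambda>_def limI)
    qed
  qed
  moreover have "\<exists>N. x \<in> ?B N" for x
  proof -
    obtain n where "norm x < real n" using reals_Archimedean2 by blast
    then show ?thesis by (intro exI[of _ n]) simp
  qed
  ultimately have "sol \<Lambda> UNIV"
    unfolding sol_def holomorphic_cn_on_def by (metis UNIV_I open_UNIV)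
  then show ?thesis by blast
qed

end

section \<open>Logarithms\<close>

text \<open>Where \<open>g\<close> differs from \<open>g x\<close> by less than 1, it equals
  \<open>g x + Ln (H y / H x)\<close>: the quotient has positive real part, and the principal branch
  inverts \<open>exp\<close> there.\<close>

lemma holomorphic_cn_on_continuous_log:
  assumes "open U" "continuous_on U g" "H holomorphic_cn_on U" "\<And>x. x \<in> U \<Longrightarrow> exp (g x) = H x"
  shows "g holomorphic_cn_on U"
proof (rule holomorphic_cn_on_local)
  fix x assume x: "x \<in> U"
  let ?V = "U \<inter> g -` ball (g x) 1"
  have V: "open ?V" by (rule continuous_open_preimage[OF assms(2,1) open_ball])
  have Im: "\<bar>Im (g y - g x)\<bar> < 1" if "y \<in> ?V" for y
    using that abs_Im_le_cmod[of "g y - g x"] by (auto simp: dist_norm norm_minus_commute)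
  have quot: "H y / H x = exp (g y - g x)" if "y \<in> ?V" for y
    using assms(4) that x by (simp add: exp_diff flip: assms(4))
  have "(\<lambda>y. g x + Ln (H y / H x)) holomorphic_cn_on ?V"
  proof (intro holomorphic_cn_on_add holomorphic_cn_on_const holomorphic_cn_on_Ln holomorphic_cn_on_divide)
    show "H holomorphic_cn_on ?V" using assms(3) by (rule holomorphic_cn_on_subset) auto
    show "H x \<noteq> 0" using assms(4)[OF x] exp_not_eq_zero[of "g x"] by simp
    fix y assume y: "y \<in> ?V"
    have "\<bar>Im (g y - g x)\<bar> < pi / 2" using Im[OF y] pi_gt3 by linarith
    then have "Re (H y / H x) > 0"
      unfolding quot[OF y] Re_exp by (intro mult_pos_pos cos_gt_zero_pi) (simp, linarith+)
    then show "H y / H x \<notin> \<real>\<^sub>\<le>\<^sub>0" by (auto simp: complex_nonpos_Reals_iff)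
  qed
  moreover have "g x + Ln (H y / H x) = g y" if y: "y \<in> ?V" for y
  proof -
    have "Ln (exp (g y - g x)) = g y - g x"
      using Im[OF y] pi_gt3 by (intro Ln_exp) linarith+
    then show ?thesis by (simp add: quot[OF y])
  qed
  ultimately have "g holomorphic_cn_on ?V" by (rule holomorphic_cn_on_cong[OF V])
  moreover have "x \<in> ?V" using x by simp
  ultimately show "\<exists>V. x \<in> V \<and> g holomorphic_cn_on V" by (intro exI[of _ ?V] conjI)
qed

text \<open>The whole space is contractible, which gives a continuous logarithm; its holomorphy is
  automatic.\<close>

lemma holomorphic_cn_log_exists:
  fixes H :: "complex ^ 'n \<Rightarrow> complex"
  assumes "H holomorphic_cn_on UNIV" "\<And>x. H x \<noteq> 0"
  obtains g where "g holomorphic_cn_on UNIV" "\<And>x. exp (g x) = H x"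
proof -
  have "contractible (UNIV :: (complex ^ 'n) set)" by (intro convex_imp_contractible convex_UNIV)
  then obtain g where g: "continuous_on UNIV g" "\<And>x. H x = exp (g x)"
    using continuous_logarithm_on_contractible[OF holomorphic_cn_on_imp_continuous_on[OF assms(1)]] assms(2)
    by (metis UNIV_I)
  show ?thesis
    by (rule that[of g] holomorphic_cn_on_continuous_log[OF open_UNIV g(1) assms(1)] g(2)[symmetric])+
qed

text \<open>The correction term vanishes wherever \<open>F\<close> is already a logarithm of \<open>h\<close>.\<close>

lemma log_correction:
  assumes "open U" "F holomorphic_cn_on U" "h holomorphic_cn_on U"
  defines "V \<equiv> {y \<in> U. 0 < Re (h y * exp (- F y))}"
    and "F' \<equiv> \<lambda>y. F y + Ln (h y * exp (- F y))"
  shows "open V" "F' holomorphic_cn_on V" "\<And>y. y \<in> V \<Longrightarrow> exp (F' y) = h y"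
    and "\<And>y. y \<in> U \<Longrightarrow> exp (F y) = h y \<Longrightarrow> y \<in> V \<and> F' y = F y"
proof -
  \<comment> \<open>This quotient is 1 exactly where \<open>F\<close> is a logarithm of
    \<open>h\<close>; a positive real part keeps it off the branch cut of \<open>Ln\<close>.\<close>
  let ?q = "\<lambda>y. h y * exp (- F y)"
  have q: "?q holomorphic_cn_on U"
    using assms(2,3) by (intro holomorphic_cn_on_mult holomorphic_cn_on_exp holomorphic_cn_on_uminus)
  have "open (U \<inter> ?q -` {z. 0 < Re z})"
    by (rule continuous_open_preimage[OF holomorphic_cn_on_imp_continuous_on[OF q] assms(1)])
       (simp add: open_halfspace_Re_gt)
  moreover have "U \<inter> ?q -` {z. 0 < Re z} = V" by (auto simp: V_def)
  ultimately show "open V" by simp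
  have VU: "V \<subseteq> U" by (auto simp: V_def)
  show "F' holomorphic_cn_on V" unfolding F'_def
    by (intro holomorphic_cn_on_add holomorphic_cn_on_Ln holomorphic_cn_on_subset[OF assms(2) VU]
          holomorphic_cn_on_subset[OF q VU]) (auto simp: V_def complex_nonpos_Reals_iff)
  show "exp (F' y) = h y" if "y \<in> V" for y
  proof -
    have "?q y \<noteq> 0" using that unfolding V_def by force
    then have "exp (F' y) = exp (F y) * ?q y" unfolding F'_def exp_add by simp
    then show ?thesis by (simp add: exp_minus)
  qed
  show "y \<in> V \<and> F' y = F y" if "y \<in> U" "exp (F y) = h y" for y
  proof -
    have "?q y = 1" using that(2)[symmetric] by (simp add: exp_minus)
    then show ?thesis using that(1) unfolding V_def F'_def mem_Collect_eq by (simp only:) simp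
  qed
qed

section \<open>Congruences modulo \<open>k\<close> for logarithms and exponentials\<close>

lemma exp_minus_one_factor:
  obtains q :: "complex \<Rightarrow> complex" where "q holomorphic_on UNIV" "\<And>w. exp w - 1 = w * q w"
proof -
  define q where "q w = (if w = 0 then 1 else (exp w - 1) / w)" for w :: complex
  have "deriv (\<lambda>w :: complex. exp w - 1) 0 = 1"
    by (rule DERIV_imp_deriv) (auto intro!: derivative_eq_intros)
  then have "q holomorphic_on UNIV"
    by (intro pole_theorem_0[of "\<lambda>w. exp w - 1" UNIV 0 q]) (auto simp: q_def intro!: holomorphic_intros)
  then show ?thesis by (rule that) (simp add: q_def)
qed

text \<open>From \<open>\<Lambda> = F + k * G\<close> follows
  \<open>exp \<Lambda> = h * exp (k * G)\<close>, and \<open>exp w - 1 = w * q w\<close> at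
  \<open>w = k * G\<close> exhibits the factor \<open>k\<close>.\<close>

lemma germ_dvd_exp_diff:
  assumes k: "k holomorphic_cn_on UNIV" and "germ_dvd k (\<lambda>y. \<Lambda> y - F y) p" "open V" "p \<in> V"
    "h holomorphic_cn_on V" "\<And>y. y \<in> V \<Longrightarrow> exp (F y) = h y"
  shows "germ_dvd k (\<lambda>y. h y - exp (\<Lambda> y)) p"
proof -
  obtain W G where W: "open W" "p \<in> W" "G holomorphic_cn_on W" "\<And>y. y \<in> W \<Longrightarrow> \<Lambda> y - F y = k y * G y"
    using assms(2) unfolding germ_dvd_def by blast
  obtain q :: "complex \<Rightarrow> complex" where q: "q holomorphic_on UNIV" "\<And>w. exp w - 1 = w * q w"
    using exp_minus_one_factor by blast
  show ?thesis
  proof (rule germ_dvdI)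
    show "open (V \<inter> W)" "p \<in> V \<inter> W" using assms W by auto
    show "(\<lambda>y. h y * (- G y * q (k y * G y))) holomorphic_cn_on V \<inter> W"
      using assms(5) W(3) k
      by (intro holomorphic_cn_on_mult holomorphic_cn_on_uminus
           holomorphic_cn_on_compose_holomorphic[OF _ q(1) open_UNIV])
         (auto intro: holomorphic_cn_on_subset)
    fix y assume y: "y \<in> V \<inter> W"
    then have "\<Lambda> y = F y + k y * G y" using W(4)[of y] by (simp add: algebra_simps)
    then have "exp (\<Lambda> y) = h y * (1 + k y * G y * q (k y * G y))"
      using assms(6)[of y] y q(2)[of "k y * G y"] by (simp add: exp_add algebra_simps)
    then show "h y - exp (\<Lambda> y) = k y * (h y * (- G y * q (k y * G y)))"
      by (simp add: algebra_simps)
  qed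
qed

text \<open>The difference takes values in the integer multiples of \<open>2 * pi * \<i>\<close>, is
  continuous and vanishes at \<open>p\<close>, hence vanishes near \<open>p\<close>. The quotient 0
  thus serves for every \<open>k\<close>, whatever the multiplicities of its zeros.\<close>

lemma germ_dvd_log_diff:
  assumes "open V" "p \<in> V" "F holomorphic_cn_on V" "F' holomorphic_cn_on V"
    and "\<And>y. y \<in> V \<Longrightarrow> exp (F y) = exp (F' y)" "F p = F' p"
  shows "germ_dvd k (\<lambda>y. F y - F' y) p"
proof (rule germ_dvdI)
  let ?W = "V \<inter> (\<lambda>y. F y - F' y) -` ball 0 1"
  show "open ?W"
    by (intro continuous_open_preimage holomorphic_cn_on_imp_continuous_on holomorphic_cn_on_diff assms open_ball)
  show "p \<in> ?W" using assms by simp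
  show "(\<lambda>_. 0) holomorphic_cn_on ?W" by simp
  fix y assume y: "y \<in> ?W"
  have "\<bar>Im (F y - F' y)\<bar> < 1"
    using y abs_Im_le_cmod[of "F y - F' y"] by (auto simp: dist_norm norm_minus_commute)
  then have "Ln (exp (F y - F' y)) = F y - F' y"
    using pi_gt3 by (intro Ln_exp) linarith+
  moreover have "exp (F y - F' y) = 1" using assms(5)[of y] y by (simp add: exp_diff)
  ultimately show "F y - F' y = k y * 0" by simp
qed

lemma entire_log_modulo:
  fixes h k :: "complex ^ 'n \<Rightarrow> complex"
  assumes h: "h holomorphic_cn_on UNIV" and k: "k holomorphic_cn_on UNIV" "k w \<noteq> 0"
    and l: "l holomorphic_on_subset (zero_set k)" "\<And>x. x \<in> zero_set k \<Longrightarrow> exp (l x) = h x"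
  obtains \<Lambda> f where "\<Lambda> holomorphic_cn_on UNIV" "f holomorphic_cn_on UNIV"
    "\<And>x. h x - exp (\<Lambda> x) = k x * f x"
proof -
  have "\<exists>V F. open V \<and> z \<in> V \<and> F holomorphic_cn_on V \<and> (\<forall>y\<in>V. exp (F y) = h y)
      \<and> (\<forall>y\<in>V \<inter> zero_set k. F y = l y)" if z: "z \<in> zero_set k" for z
  proof -
    obtain U F where U: "open U" "z \<in> U" "F holomorphic_cn_on U" "\<forall>y\<in>U \<inter> zero_set k. F y = l y"
      using l(1) z unfolding holomorphic_on_subset_def by blast
    \<comment> \<open>The extension \<open>F\<close> of \<open>l\<close> is known to be a logarithm
      of \<open>h\<close> only on \<open>zero_set k\<close>; the correction makes it one on an open
      set and keeps its values on \<open>zero_set k\<close>.\<close>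
    note corr = log_correction[OF U(1,3) holomorphic_cn_on_subset[OF h subset_UNIV]]
    show ?thesis
    proof (intro exI conjI ballI)
      show "open {y \<in> U. 0 < Re (h y * exp (- F y))}" by (rule corr(1))
      show "(\<lambda>y. F y + Ln (h y * exp (- F y))) holomorphic_cn_on {y \<in> U. 0 < Re (h y * exp (- F y))}" by (rule corr(2))
      show "z \<in> {y \<in> U. 0 < Re (h y * exp (- F y))}" using corr(4)[of z] U l(2) z by auto
      show "exp (F y + Ln (h y * exp (- F y))) = h y" if "y \<in> {y \<in> U. 0 < Re (h y * exp (- F y))}" for y
        using that by (rule corr(3))
      show "F y + Ln (h y * exp (- F y)) = l y" if "y \<in> {y \<in> U. 0 < Re (h y * exp (- F y))} \<inter> zero_set k" for y
        using that U(4) corr(4)[of y] l(2)[of y] by auto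
    qed
  qed
  then have "\<forall>z\<in>zero_set k. \<exists>V F. open V \<and> z \<in> V \<and> F holomorphic_cn_on V \<and> (\<forall>y\<in>V. exp (F y) = h y)
      \<and> (\<forall>y\<in>V \<inter> zero_set k. F y = l y)" by blast
  then obtain V0 F0 where "\<forall>z\<in>zero_set k. open (V0 z) \<and> z \<in> V0 z \<and> F0 z holomorphic_cn_on V0 z
      \<and> (\<forall>y\<in>V0 z. exp (F0 z y) = h y) \<and> (\<forall>y\<in>V0 z \<inter> zero_set k. F0 z y = l y)"
    unfolding bchoice_iff by blast
  then have VF: "\<And>z. z \<in> zero_set k \<Longrightarrow> open (V0 z)" "\<And>z. z \<in> zero_set k \<Longrightarrow> z \<in> V0 z"
    "\<And>z. z \<in> zero_set k \<Longrightarrow> F0 z holomorphic_cn_on V0 z" "\<And>z y. z \<in> zero_set k \<Longrightarrow> y \<in> V0 z \<Longrightarrow> exp (F0 z y) = h y"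
    "\<And>z y. z \<in> zero_set k \<Longrightarrow> y \<in> V0 z \<inter> zero_set k \<Longrightarrow> F0 z y = l y"
    by blast+
  \<comment> \<open>Off the zero set there is nothing to prescribe: the function 0 on the complement
    serves as data, because \<open>k\<close> is a unit there.\<close>
  define V where "V x = (if x \<in> zero_set k then V0 x else - zero_set k)" for x
  define F where "F x = (if x \<in> zero_set k then F0 x else (\<lambda>_. 0))" for x
  have "closed (zero_set k)"
  proof -
    have "open (UNIV \<inter> k -` (- {0}))"
      by (intro continuous_open_preimage holomorphic_cn_on_imp_continuous_on k) auto
    moreover have "UNIV \<inter> k -` (- {0}) = - zero_set k" by (auto simp: zero_set_def)
    ultimately show ?thesis by (simp add: closed_def)
  qed
  have openV: "open (V x)" and memV: "x \<in> V x" and holF: "F x holomorphic_cn_on V x" for x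
    using VF \<open>closed (zero_set k)\<close> by (auto simp: V_def F_def closed_def)
  have comp: "germ_dvd k (\<lambda>y. F x y - F p y) p" if p: "p \<in> V x" for x p
  proof (cases "p \<in> zero_set k")
    case False
    show ?thesis
    proof (rule germ_dvd_nonzero)
      show "open (V x \<inter> V p)" "p \<in> V x \<inter> V p" using openV memV p by auto
      show "(\<lambda>y. F x y - F p y) holomorphic_cn_on V x \<inter> V p"
        by (intro holomorphic_cn_on_diff holomorphic_cn_on_subset[OF holF]) auto
    qed (use False k in \<open>auto simp: zero_set_def intro: holomorphic_cn_on_subset\<close>)
  next
    case True
    \<comment> \<open>Neighbourhoods assigned to points off \<open>zero_set k\<close> contain no
      point of it. So both representatives are logarithms of \<open>h\<close>, and both take the
      value \<open>l p\<close> at \<open>p\<close>.\<close>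
    then have x: "x \<in> zero_set k" using p by (auto simp: V_def split: if_splits)
    show ?thesis
    proof (rule germ_dvd_log_diff)
      show "open (V x \<inter> V p)" "p \<in> V x \<inter> V p" using openV memV p by auto
      show "F x holomorphic_cn_on V x \<inter> V p" "F p holomorphic_cn_on V x \<inter> V p"
        by (intro holomorphic_cn_on_subset[OF holF]; auto)+
      show "exp (F x y) = exp (F p y)" if "y \<in> V x \<inter> V p" for y
        using VF(4)[OF x, of y] VF(4)[OF True, of y] that x True by (auto simp: V_def F_def)
      show "F x p = F p p"
        using VF(5)[OF x, of p] VF(5)[OF True, of p] VF(2)[OF True] p x True by (auto simp: V_def F_def)
    qed
  qed
  interpret principal_cousin k w F V
    by standard (use k openV memV holF comp in auto)
  obtain \<Lambda> where "sol \<Lambda> UNIV" using entire_sol by blast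
  then have \<Lambda>: "\<Lambda> holomorphic_cn_on UNIV" "\<And>p. germ_dvd k (\<lambda>y. \<Lambda> y - F p y) p"
    by (auto simp: sol_def)
  have "germ_dvd k (\<lambda>y. h y - exp (\<Lambda> y)) p" for p
  proof (cases "p \<in> zero_set k")
    case True
    show ?thesis
      by (rule germ_dvd_exp_diff[OF k(1) \<Lambda>(2) openV memV holomorphic_cn_on_subset[OF h subset_UNIV]])
         (use VF(4)[OF True] True in \<open>auto simp: V_def F_def\<close>)
  next
    case False
    then show ?thesis
      by (intro germ_dvd_nonzero[OF open_UNIV] holomorphic_cn_on_diff holomorphic_cn_on_exp h k \<Lambda>)
         (auto simp: zero_set_def)
  qed
  then have "\<exists>f. f holomorphic_cn_on UNIV \<and> (\<forall>y\<in>UNIV. h y - exp (\<Lambda> y) = k y * f y)"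
    by (rule germ_dvd_imp_global[OF k open_UNIV])
  then obtain f where "f holomorphic_cn_on UNIV" "\<And>x. h x - exp (\<Lambda> x) = k x * f x" by auto
  with \<Lambda>(1) show ?thesis by (rule that)
qed

section \<open>The three equivalences\<close>

theorem lemma4p2:
  fixes m :: "complex ^ 'n \<Rightarrow> P1"
    and h k :: "complex ^ 'n \<Rightarrow> complex"
  assumes "holomorphic_map_P1 m"
    and "h holomorphic_cn_on UNIV"
    and "k holomorphic_cn_on UNIV"
    and "\<And>x. \<not> (h x = 0 \<and> k x = 0)"
    and "\<And>x. m x = P1_quot (h x) (k x)"
  defines "stmt1 \<equiv> \<exists>f g :: complex ^ 'n \<Rightarrow> complex.
      f holomorphic_cn_on UNIV \<and> g holomorphic_cn_on UNIV \<and>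
      (\<forall>x. m x = P1_translate (f x) (P1_quot 1 (g x)))"
    and "stmt2 \<equiv> \<exists>l :: complex ^ 'n \<Rightarrow> complex.
      l holomorphic_on_subset (zero_set k) \<and> (\<forall>x\<in>zero_set k. exp (l x) = h x)"
    and "stmt3 \<equiv> \<exists>(U :: (complex ^ 'n) set) (l :: complex ^ 'n \<Rightarrow> complex).
      open U \<and> zero_set k \<subseteq> U \<and> l holomorphic_cn_on U \<and> (\<forall>x\<in>U. exp (l x) = h x)"
  shows "(stmt1 \<longleftrightarrow> stmt2) \<and> (stmt2 \<longleftrightarrow> stmt3)"
proof -
  have "stmt3" if stmt1
  proof -
    obtain f g where f: "f holomorphic_cn_on UNIV"
      and fg: "\<And>x. P1_quot (h x) (k x) = P1_translate (f x) (P1_quot 1 (g x))"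
      using \<open>stmt1\<close> assms(5) unfolding stmt1_def by metis
    let ?H = "\<lambda>x. h x - f x * k x"
    have "?H holomorphic_cn_on UNIV"
      by (intro holomorphic_cn_on_diff holomorphic_cn_on_mult f assms)
    \<comment> \<open>At zeros of \<open>k\<close> this is the absence of common zeros; elsewhere
      the formula for \<open>m\<close> gives \<open>?H x = k x / g x\<close>.\<close>
    moreover have "?H x \<noteq> 0" for x
    proof (cases "k x = 0")
      case True
      then show ?thesis using assms(4)[of x] by simp
    next
      case False
      then have "g x \<noteq> 0" "h x / k x = f x + 1 / g x"
        using fg[of x] by (auto simp: P1_quot_def split: if_splits)
      then have "?H x = k x / g x" using False by (simp add: field_simps)
      then show ?thesis using False \<open>g x \<noteq> 0\<close> by simp
    qed
    ultimately obtain L where L: "L holomorphic_cn_on UNIV" "\<And>x. exp (L x) = ?H x"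
      using holomorphic_cn_log_exists[of ?H] by blast
    note corr = log_correction[OF open_UNIV L(1) assms(2)]
    have "zero_set k \<subseteq> {y \<in> UNIV. 0 < Re (h y * exp (- L y))}"
    proof
      fix y assume "y \<in> zero_set k"
      then have "exp (L y) = h y" by (simp add: L(2) zero_set_def)
      with corr(4)[of y] show "y \<in> {y \<in> UNIV. 0 < Re (h y * exp (- L y))}" by blast
    qed
    with corr(1-3) show ?thesis unfolding stmt3_def by blast
  qed
  moreover have stmt2 if s3: stmt3
  proof -
    from s3[unfolded stmt3_def] obtain U l where "open U \<and> zero_set k \<subseteq> U \<and> l holomorphic_cn_on U \<and> (\<forall>x\<in>U. exp (l x) = h x)"
      by (elim exE)
    then have U: "open U" "zero_set k \<subseteq> U" "l holomorphic_cn_on U" "\<forall>x\<in>U. exp (l x) = h x" by auto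
    have "l holomorphic_on_subset zero_set k"
      unfolding holomorphic_on_subset_def
      by (intro ballI exI[of _ U] exI[of _ l]) (use U in auto)
    moreover have "\<forall>x\<in>zero_set k. exp (l x) = h x" using U(2,4) by (simp add: subset_iff)
    ultimately show ?thesis unfolding stmt2_def by (intro exI[of _ l] conjI)
  qed
  moreover have stmt1 if s2: stmt2
  proof (cases "\<exists>w. k w \<noteq> 0")
    \<comment> \<open>Here \<open>k\<close> vanishes identically and \<open>m\<close> is the
      constant \<open>Infty\<close>, which corresponds to \<open>g = 0\<close>.\<close>
    case False
    then have "m x = P1_translate 0 (P1_quot 1 0)" for x
      using assms(5) by (simp add: P1_quot_def)
    then show ?thesis unfolding stmt1_def
      by (intro exI[of _ "\<lambda>_. 0"]) simp
  next
    case True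
    obtain l where l: "l holomorphic_on_subset (zero_set k)" "\<And>x. x \<in> zero_set k \<Longrightarrow> exp (l x) = h x"
      using s2[unfolded stmt2_def] by (elim exE conjE) (rule that, assumption, blast)
    obtain w where "k w \<noteq> 0" using True ..
    obtain \<Lambda> f where \<Lambda>: "\<Lambda> holomorphic_cn_on UNIV" and f: "f holomorphic_cn_on UNIV"
      and eq: "\<And>x. h x - exp (\<Lambda> x) = k x * f x"
      using entire_log_modulo[OF assms(2,3) \<open>k w \<noteq> 0\<close> l] by blast
    have "(\<lambda>x. k x * exp (- \<Lambda> x)) holomorphic_cn_on UNIV"
      by (intro holomorphic_cn_on_mult holomorphic_cn_on_exp holomorphic_cn_on_uminus \<Lambda> assms)
    \<comment> \<open>At zeros of \<open>k\<close> the function \<open>k * exp (- \<Lambda>)\<close>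
      vanishes too, so both sides are \<open>Infty\<close>.\<close>
    moreover have "m x = P1_translate (f x) (P1_quot 1 (k x * exp (- \<Lambda> x)))" for x
    proof (cases "k x = 0")
      case False
      have "h x / k x = f x + 1 / (k x * exp (- \<Lambda> x))"
        using eq[of x] False by (simp add: exp_minus field_simps)
      then show ?thesis using False by (simp add: assms(5) P1_quot_def)
    qed (simp add: assms(5) P1_quot_def)
    ultimately show ?thesis using f unfolding stmt1_def
      by (intro exI[of _ f] exI[of _ "\<lambda>x. k x * exp (- \<Lambda> x)"] conjI allI)
  qed
  ultimately show ?thesis by blast
qed

end
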